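(* Let $\gamma(t)=(x(t),\ell(t),y(t))$, $t\ge 0$, be a sub-Riemannian geodesic of $(N,\mathcal N,g)$ with $\gamma(0)=o$. Then either $\gamma(t)\notin C_{\mathfrak n}$ for all $t>0$, or $\gamma(t)\in C_{\mathfrak n}$ for all $t\ge 0$.
   Context: Let $N=\mathbb R\times\mathbb R^3\times\mathbb R^3$ with coordinates $(x,\ell,y)$, $\ell=(\ell_1,\ell_2,\ell_3)^t$, $y=(y_1,y_2,y_3)^t$, be the Carnot group with product $(x,\ell,y)\cdot(\tilde x,\tilde\ell,\tilde y)=(x+\tilde x,\ \ell+\tilde\ell,\ y+\tilde y+\tfrac12(x\tilde\ell-\tilde x\ell))$ and identity element (origin) $o=(0,0,0)$. Consider the left-invariant vector fields $$N_0=\partial_x-\tfrac12\sum_{i=1}^3\ell_i\,\partial_{y_i},\qquad N_i=\partial_{\ell_i}+\tfrac{x}{2}\,\partial_{y_i},\quad i=1,2,3.$$ Let $\mathcal N=\langle N_0,N_1,N_2,N_3\rangle$ be the rank 4 distribution they span and let $g$ be the sub-Riemannian metric on $\mathcal N$ for which $N_0,N_1,N_2,N_3$ are orthonormal. Geodesics are admissible curves (tangent to $\mathcal N$) parametrized by constant speed whose sufficiently small arcs are length minimizers; they are the projections to $N$ of solutions of the Hamiltonian system of Pontryagin's maximum principle with Hamiltonian $H=\tfrac12(h_0^2+h_1^2+h_2^2+h_3^2)$, $h_i(\lambda)=\lambda(N_i)$, on $T^*N$ (there are no strictly abnormal geodesics). The set $C_{\mathfrak n}$ is $$C_{\mathfrak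 n}=\{(x,\ell,y)\in\mathbb R\times\mathbb R^3\times\mathbb R^3:\ \ell\text{ and }y\text{ are linearly dependent}\}.$$ *)

theory Defs
  imports "HOL-Analysis.Analysis"
begin

type_synonym carnot = "real \<times> (real^3) \<times> (real^3)"

definition origin :: carnot where
  "origin = (0, 0, 0)"

definition carnot_mult :: "carnot \<Rightarrow> carnot \<Rightarrow> carnot" where
  "carnot_mult p q = (case p of (x, l, y) \<Rightarrow> case q of (x', l', y') \<Rightarrow>
     (x + x', l + l', y + y' + (1/2) *\<^sub>R (x *\<^sub>R l' - x' *\<^sub>R l)))"

text \<open>
  Tangent spaces of the group are identified with the ambient vector space through the
  coordinate vector fields, so a vector field is a map from points to vectors.
\<close>

definition N0 :: "carnot \<Rightarrow> carnot" where
  "N0 p = (case p of (x, l, y) \<Rightarrow> (1, 0, - (1/2) *\<^sub>R l))"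

definition Ni :: "3 \<Rightarrow> carnot \<Rightarrow> carnot" where
  "Ni i p = (case p of (x, l, y) \<Rightarrow> (0, axis i 1, (x/2) *\<^sub>R axis i 1))"

definition distribution :: "carnot \<Rightarrow> carnot set" where
  "distribution p = span (insert (N0 p) (range (\<lambda>i. Ni i p)))"

definition frame_comb :: "carnot \<Rightarrow> real \<times> (real^3) \<Rightarrow> carnot" where
  "frame_comb p u = fst u *\<^sub>R N0 p + (\<Sum>i\<in>UNIV. (snd u $ i) *\<^sub>R Ni i p)"

text \<open>
  The coordinates of a vector of the distribution in the frame; they are unique by
  \<open>inj_frame_comb\<close> below. The definition is meaningful only for vectors of the distribution.
\<close>

definition frame_coords :: "carnot \<Rightarrow> carnot \<Rightarrow> real \<times> (real^3)" where
  "frame_coords p v = (THE u. frame_comb p u = v)"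

text \<open>
  The inner product of the product type \<open>real \<times> real^3\<close> is the Euclidean one, hence this
  is the metric in which the frame is orthonormal (see \<open>sr_metric_orthonormal\<close>).
\<close>

definition sr_metric :: "carnot \<Rightarrow> carnot \<Rightarrow> carnot \<Rightarrow> real" where
  "sr_metric p v w = frame_coords p v \<bullet> frame_coords p w"

definition sr_norm :: "carnot \<Rightarrow> carnot \<Rightarrow> real" where
  "sr_norm p v = sqrt (sr_metric p v v)"

text \<open>
  Admissible curves are taken in the Lipschitz class, tangent to the distribution almost
  everywhere. Every absolutely continuous horizontal curve has a Lipschitz
  reparametrization of the same length, so this gives the usual length minimizers.
\<close>

definition admissible_on :: "real set \<Rightarrow> (real \<Rightarrow> carnot) \<Rightarrow> bool" where
  "admissible_on S c \<longleftrightarrow>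
     (\<exists>L. L-lipschitz_on S c) \<and>
     (AE t in lebesgue. t \<in> S \<longrightarrow>
        (\<exists>v \<in> distribution (c t). (c has_vector_derivative v) (at t within S)))"

definition sr_length :: "(real \<Rightarrow> carnot) \<Rightarrow> real \<Rightarrow> real \<Rightarrow> real" where
  "sr_length c a b =
     integral {a..b} (\<lambda>t. sr_norm (c t) (vector_derivative c (at t within {a..b})))"

definition length_minimizer :: "(real \<Rightarrow> carnot) \<Rightarrow> real \<Rightarrow> real \<Rightarrow> bool" where
  "length_minimizer c a b \<longleftrightarrow>
     a \<le> b \<and> admissible_on {a..b} c \<and>
     (\<forall>c' a' b'. a' \<le> b' \<and> admissible_on {a'..b'} c' \<and> c' a' = c a \<and> c' b' = c b
        \<longrightarrow> sr_length c a b \<le> sr_length c' a' b')"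

text \<open>
  The set \<open>I\<close> is meant to be a nondegenerate interval. The constant speed may be zero,
  i.e. constant curves are included.
\<close>

definition sr_geodesic_on :: "real set \<Rightarrow> (real \<Rightarrow> carnot) \<Rightarrow> bool" where
  "sr_geodesic_on I c \<longleftrightarrow>
     (\<forall>a b. a \<le> b \<and> {a..b} \<subseteq> I \<longrightarrow> admissible_on {a..b} c) \<and>
     (\<exists>s. AE t in lebesgue. t \<in> I \<longrightarrow>
        sr_norm (c t) (vector_derivative c (at t within I)) = s) \<and>
     (\<forall>t\<in>I. \<exists>\<delta>>0. \<forall>a b. a \<le> b \<and> {a..b} \<subseteq> I \<inter> ball t \<delta> \<longrightarrow> length_minimizer c a b)"

text \<open>
  Linear dependence of the pair is written out because \<open>dependent {l, y}\<close>, a statement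
  about a set, fails when \<open>l = y \<noteq> 0\<close>.
\<close>

definition Cn :: "carnot set" where
  "Cn = {(x, l, y). \<exists>a b :: real. (a, b) \<noteq> (0, 0) \<and> a *\<^sub>R l + b *\<^sub>R y = 0}"

lemma N_left_invariant:
  "((\<lambda>s. carnot_mult p (q + s *\<^sub>R N0 q)) has_vector_derivative N0 (carnot_mult p q)) (at 0)"
  "((\<lambda>s. carnot_mult p (q + s *\<^sub>R Ni i q)) has_vector_derivative Ni i (carnot_mult p q)) (at 0)"
proof -
  have affine: "((\<lambda>s::real. a + s *\<^sub>R v) has_vector_derivative v) (at 0)" for a v :: carnot
    by (auto intro!: derivative_eq_intros)
  have "carnot_mult p (q + s *\<^sub>R N0 q) = carnot_mult p q + s *\<^sub>R N0 (carnot_mult p q)" for s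
    by (cases p; cases q) (auto simp: carnot_mult_def N0_def vec_eq_iff field_simps)
  then show "((\<lambda>s. carnot_mult p (q + s *\<^sub>R N0 q)) has_vector_derivative N0 (carnot_mult p q)) (at 0)"
    by (simp only: affine)
  have "carnot_mult p (q + s *\<^sub>R Ni i q) = carnot_mult p q + s *\<^sub>R Ni i (carnot_mult p q)" for s
    by (cases p; cases q) (auto simp: carnot_mult_def Ni_def vec_eq_iff field_simps)
  then show "((\<lambda>s. carnot_mult p (q + s *\<^sub>R Ni i q)) has_vector_derivative Ni i (carnot_mult p q)) (at 0)"
    by (simp only: affine)
qed

lemma frame_comb_eq:
  "frame_comb (x, l, y) (r, u) = (r, u, (1/2) *\<^sub>R (x *\<^sub>R u - r *\<^sub>R l))"
proof -
  have "(\<Sum>i\<in>UNIV. (u $ i) *\<^sub>R Ni i (x, l, y)) = (0, u, (x/2) *\<^sub>R u)"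
    by (simp add: Ni_def sum_prod vec_eq_iff axis_def if_distrib cong: if_cong)
  then show ?thesis
    by (simp add: frame_comb_def N0_def scaleR_diff_right)
qed

lemma inj_frame_comb: "inj (frame_comb p)"
  by (cases p) (auto simp: inj_on_def frame_comb_eq)

lemma frame_coords_comb [simp]: "frame_coords p (frame_comb p u) = u"
  unfolding frame_coords_def using injD[OF inj_frame_comb] by (intro the_equality) auto

lemma distribution_eq_range: "distribution p = range (frame_comb p)"
proof
  have "subspace (range (frame_comb p))"
    by (intro subspace_UNIV linear_subspace_image linearI)
       (auto simp: frame_comb_def algebra_simps sum.distrib scaleR_sum_right)
  moreover have "N0 p = frame_comb p (1, 0)"
    by (simp add: frame_comb_def)
  moreover have "Ni i p = frame_comb p (0, axis i 1)" for i
    by (cases p) (simp add: frame_comb_eq Ni_def)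
  ultimately show "distribution p \<subseteq> range (frame_comb p)"
    unfolding distribution_def by (intro span_minimal) auto
  show "range (frame_comb p) \<subseteq> distribution p"
    unfolding distribution_def frame_comb_def
    by (intro image_subsetI span_add span_sum span_mul) (auto intro: span_base)
qed

lemma sr_metric_orthonormal:
  "sr_metric p (N0 p) (N0 p) = 1"
  "sr_metric p (N0 p) (Ni i p) = 0"
  "sr_metric p (Ni i p) (Ni j p) = (if i = j then 1 else 0)"
proof -
  have N0: "N0 p = frame_comb p (1, 0)"
    by (simp add: frame_comb_def)
  have Ni: "Ni i p = frame_comb p (0, axis i 1)" for i
    by (cases p) (simp add: frame_comb_eq Ni_def)
  show "sr_metric p (N0 p) (N0 p) = 1" "sr_metric p (N0 p) (Ni i p) = 0"
    "sr_metric p (Ni i p) (Ni j p) = (if i = j then 1 else 0)"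
    by (simp_all add: sr_metric_def N0 Ni inner_axis_axis)
qed

end

theory Submission
  imports Defs
begin

text \<open>
  Write \<open>p = (x, \<ell>)\<close> for the path obtained from a horizontal curve by forgetting \<open>y\<close>. The length of the
  curve is the Euclidean length of \<open>p\<close>, and \<open>y\<close> collects the areas swept by \<open>p\<close> in the three planes
  spanned by the \<open>x\<close>-axis and an \<open>\<ell>\<^sub>i\<close>-axis. A length minimizer between two points of the group
  is therefore a solution of an isoperimetric problem: \<open>p\<close> has minimal length among the paths with given
  endpoints and three given areas.

  The first variation of this problem (\<open>minimizer_first_variation\<close>) yields a Lagrange multiplier
  \<open>\<mu> \<in> \<real>\<^sup>3\<close> (\<open>minimal_imp_multiplier\<close>), and the lemma of du Bois-Reymond turns the resulting weak equation
  into \<open>p' = c + rot \<mu> p\<close>, where \<open>rot \<mu>\<close> generates rotations in the plane of the \<open>x\<close>-axis and \<open>\<mu>\<close>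
  (\<open>multiplier_equation_imp_ode\<close>). The constraints are degenerate only if \<open>x\<close> is constant; then \<open>p\<close> is
  a straight line and satisfies the equation with \<open>\<mu> = 0\<close>. The multipliers of neighbouring arcs agree unless the
  arcs are straight (\<open>rot_ode_glue\<close>), so every initial arc of a geodesic satisfies one such
  equation (\<open>geodesic_rot_ode\<close>).

  From the origin the equation is solved explicitly. If \<open>\<mu> = 0\<close>, the geodesic is a ray with \<open>y = 0\<close> and stays in
  the set \<open>Cn\<close>. Otherwise let \<open>e = \<mu> / \<bar>\<mu>\<bar>\<close> and let \<open>w\<close> be the component of the initial
  \<open>\<ell>\<close>-velocity orthogonal to \<open>e\<close>. Then \<open>\<ell> = A e + t w\<close> and \<open>y = Y e + W w\<close> with explicit scalar
  functions. If \<open>w = 0\<close>, the vectors \<open>\<ell>\<close> and \<open>y\<close> are always dependent. If \<open>w \<noteq> 0\<close>, they are dependent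
  exactly when \<open>A W - t Y = 0\<close>, and this determinant is positive for all \<open>t > 0\<close> as soon as the
  motion in the plane of the \<open>x\<close>-axis and \<open>e\<close> is not at rest (\<open>helix_determinant_pos\<close>); if it is at
  rest, then \<open>y = 0\<close>. The positivity comes down to
  \<open>2 sin\<^sup>2 \<sigma> < \<sigma>\<^sup>2 + \<sigma> sin \<sigma> cos \<sigma>\<close> for \<open>\<sigma> > 0\<close> (\<open>two_sin_squared_less\<close>).
\<close>

section \<open>Lipschitz functions and the lemma of du Bois-Reymond\<close>

lemma difference_quotient_LIMSEQ:
  fixes f :: "real \<Rightarrow> 'a::real_normed_vector"
  assumes "(f has_vector_derivative v) (at t)"
  shows "(\<lambda>n. real (Suc n) *\<^sub>R (f (t + 1 / real (Suc n)) - f t)) \<longlonglongrightarrow> v"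
proof -
  define q where "q h = (f (t + h) - f t - h *\<^sub>R v) /\<^sub>R norm h" for h
  have "(q \<longlongrightarrow> 0) (at 0)"
  proof (rule tendsto_norm_zero_cancel)
    have "norm (q h) = norm (f (t + h) - f t - h *\<^sub>R v) / norm h" for h
      by (simp add: q_def divide_inverse_commute)
    then show "((\<lambda>h. norm (q h)) \<longlongrightarrow> 0) (at 0)"
      using assms unfolding has_vector_derivative_def has_derivative_at by simp
  qed
  moreover have "filterlim (\<lambda>n. 1 / real (Suc n)) (at 0) sequentially"
    unfolding filterlim_at using LIMSEQ_Suc[OF lim_1_over_n] by auto
  ultimately have "(\<lambda>n. q (1 / real (Suc n))) \<longlonglongrightarrow> 0"
    by (rule filterlim_compose)
  then have "(\<lambda>n. q (1 / real (Suc n)) + v) \<longlonglongrightarrow> 0 + v"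
    by (intro tendsto_intros)
  moreover have "q (1 / real (Suc n)) + v = real (Suc n) *\<^sub>R (f (t + 1 / real (Suc n)) - f t)" for n
    by (simp add: q_def scaleR_diff_right)
  ultimately show ?thesis by simp
qed

text \<open>
  The difference quotients of \<open>f\<close>, extended by constants beyond the endpoints, are bounded by
  the Lipschitz constant and converge to \<open>g\<close> almost everywhere, so dominated convergence
  applies. Their integrals are difference quotients at \<open>b\<close> and at \<open>a\<close> of a primitive of \<open>f\<close>,
  hence tend to \<open>f b - f a\<close>.
\<close>

lemma lipschitz_fundamental_theorem:
  fixes f g :: "real \<Rightarrow> 'a::euclidean_space"
  assumes lip: "L-lipschitz_on {a..b} f" and "a \<le> b" and N: "negligible N"
    and der: "\<And>t. t \<in> {a..b} - N \<Longrightarrow> (f has_vector_derivative g t) (at t within {a..b})"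
  shows "(g has_integral (f b - f a)) {a..b}"
proof -
  \<comment> \<open>The constant extension makes \<open>f (s + \<delta>)\<close> meaningful for \<open>s\<close> near \<open>b\<close>.\<close>
  define F where "F s = f (max a (min b s))" for s
  have cl: "max a (min b s) \<in> {a..b}" for s using \<open>a \<le> b\<close> by auto
  have Flip: "norm (F s - F t) \<le> L * \<bar>s - t\<bar>" for s t
  proof -
    have "norm (F s - F t) \<le> L * \<bar>max a (min b s) - max a (min b t)\<bar>"
      unfolding F_def using lipschitz_on_normD[OF lip cl cl] by simp
    also have "\<dots> \<le> L * \<bar>s - t\<bar>"
      using lipschitz_on_nonneg[OF lip] by (intro mult_left_mono) auto
    finally show ?thesis .
  qed
  have "L-lipschitz_on UNIV F"
    by (rule lipschitz_onI) (auto simp: dist_norm Flip lipschitz_on_nonneg[OF lip])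
  then have Fcont: "continuous_on X F" for X
    using lipschitz_on_continuous_on continuous_on_subset by blast
  define \<Phi> where "\<Phi> t = integral {a-1..t} F" for t
  have \<Phi>: "(\<Phi> has_vector_derivative F t) (at t)" if "a - 1 < t" "t < b + 2" for t
  proof -
    have "(\<Phi> has_vector_derivative F t) (at t within {a-1..b+2})"
      unfolding \<Phi>_def using that Fcont by (intro integral_has_vector_derivative) auto
    then show ?thesis using that at_within_Icc_at[of "a-1" t "b+2"] by simp
  qed
  define \<delta> where "\<delta> n = 1 / real (Suc n)" for n
  have \<delta>: "0 < \<delta> n" "\<delta> n \<le> 1" for n by (auto simp: \<delta>_def)
  define h where "h n s = real (Suc n) *\<^sub>R (F (s + \<delta> n) - F s)" for n s
  define y where "y n = real (Suc n) *\<^sub>R (\<Phi> (b + \<delta> n) - \<Phi> b) - real (Suc n) *\<^sub>R (\<Phi> (a + \<delta> n) - \<Phi> a)" for n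
  have hy: "(h n has_integral y n) {a..b}" for n
  proof -
    let ?P = "\<lambda>s. real (Suc n) *\<^sub>R (\<Phi> (s + \<delta> n) - \<Phi> s)"
    have "(?P has_vector_derivative h n s) (at s within {a..b})" if "s \<in> {a..b}" for s
    proof -
      have "((\<lambda>s. s + \<delta> n) has_vector_derivative 1) (at s within {a..b})"
        by (auto intro!: derivative_eq_intros)
      moreover have "(\<Phi> has_vector_derivative F (s + \<delta> n)) (at (s + \<delta> n) within (\<lambda>s. s + \<delta> n) ` {a..b})"
        using that \<delta>[of n] by (intro has_vector_derivative_at_within[OF \<Phi>]) auto
      ultimately have "((\<lambda>s. \<Phi> (s + \<delta> n)) has_vector_derivative 1 *\<^sub>R F (s + \<delta> n)) (at s within {a..b})"
        using vector_diff_chain_within unfolding o_def by blast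
      moreover have "(\<Phi> has_vector_derivative F s) (at s within {a..b})"
        using that by (intro \<Phi>[THEN has_vector_derivative_at_within]) auto
      ultimately show ?thesis unfolding h_def
        by (auto intro!: derivative_eq_intros)
    qed
    then have "(h n has_integral ?P b - ?P a) {a..b}"
      by (rule fundamental_theorem_of_calculus[OF \<open>a \<le> b\<close>])
    then show ?thesis by (simp add: y_def)
  qed
  have ylim: "y \<longlonglongrightarrow> f b - f a"
  proof -
    have "y \<longlonglongrightarrow> F b - F a"
      unfolding y_def \<delta>_def
      by (intro tendsto_diff difference_quotient_LIMSEQ \<Phi>) (use \<open>a \<le> b\<close> in auto)
    then show ?thesis using \<open>a \<le> b\<close> by (simp add: F_def)
  qed
  define N' where "N' = N \<union> {a, b}"
  define h' where "h' n s = (if s \<in> N' then 0 else h n s)" for n s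
  define g' where "g' s = (if s \<in> N' then 0 else g s)" for s
  have N': "negligible N'" unfolding N'_def using N by (intro negligible_Un) auto
  have "(g' has_integral f b - f a) {a..b}"
  proof (rule has_integral_dominated_convergence)
    show "(h' n has_integral y n) {a..b}" for n
      by (rule has_integral_spike[OF N' _ hy]) (simp add: h'_def)
    show "(\<lambda>_. L) integrable_on {a..b}" by (rule integrable_const_ivl)
    show "\<forall>s\<in>{a..b}. norm (h' n s) \<le> L" for n
    proof
      fix s
      have "norm (h n s) \<le> real (Suc n) * (L * \<delta> n)"
        unfolding h_def using Flip[of "s + \<delta> n" s] \<delta>[of n] by (auto intro!: mult_left_mono)
      then show "norm (h' n s) \<le> L"
        using lipschitz_on_nonneg[OF lip] by (auto simp: h'_def \<delta>_def)
    qed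
    show "\<forall>s\<in>{a..b}. (\<lambda>n. h' n s) \<longlonglongrightarrow> g' s"
    proof
      fix s assume s: "s \<in> {a..b}"
      show "(\<lambda>n. h' n s) \<longlonglongrightarrow> g' s"
      proof (cases "s \<in> N'")
        case False
        with s have "a < s" "s < b" "s \<in> {a..b} - N" by (auto simp: N'_def)
        then have "(f has_vector_derivative g s) (at s)"
          using der[of s] at_within_Icc_at[of a s b] by simp
        moreover have "\<forall>\<^sub>F x in nhds s. F x = f x"
          using eventually_nhds_in_open[of "{a<..<b}" s] \<open>a < s\<close> \<open>s < b\<close>
          by (auto elim!: eventually_mono simp: F_def)
        ultimately have "(F has_vector_derivative g s) (at s)"
          using has_vector_derivative_cong_ev[where S=UNIV and f=F and g=f and x=s]
          by (auto dest: eventually_nhds_x_imp_x)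
        from difference_quotient_LIMSEQ[OF this] False show ?thesis
          by (simp add: h'_def g'_def h_def \<delta>_def)
      qed (simp add: h'_def g'_def)
    qed
    show "y \<longlonglongrightarrow> f b - f a" by (rule ylim)
  qed
  then show ?thesis
    by (rule has_integral_spike[OF N', rotated]) (simp add: g'_def)
qed

text \<open>
  For a Lipschitz path \<open>F\<close> and \<open>\<psi>' = d\<psi>/dt\<close> this is the integral of \<open>F' \<bullet> \<psi>\<close> over \<open>[a, b]\<close>,
  written by partial integration. It involves only continuous integrands, so once the first
  variation has been put into this form no almost-everywhere derivative occurs any more.
\<close>

definition weak_pairing ::
    "real \<Rightarrow> real \<Rightarrow> (real \<Rightarrow> 'a::real_inner) \<Rightarrow> (real \<Rightarrow> 'a) \<Rightarrow> (real \<Rightarrow> 'a) \<Rightarrow> real" where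
  "weak_pairing a b F \<psi> \<psi>' = F b \<bullet> \<psi> b - F a \<bullet> \<psi> a - integral {a..b} (\<lambda>t. F t \<bullet> \<psi>' t)"

text \<open>
  Test functions are velocities of variations: mean value zero says that the variation, a
  primitive of \<open>\<psi>\<close>, can vanish at both endpoints.
\<close>

definition test_function ::
    "real \<Rightarrow> real \<Rightarrow> (real \<Rightarrow> 'a::euclidean_space) \<Rightarrow> (real \<Rightarrow> 'a) \<Rightarrow> bool" where
  "test_function a b \<psi> \<psi>' \<longleftrightarrow>
     (\<forall>t\<in>{a..b}. (\<psi> has_vector_derivative \<psi>' t) (at t within {a..b})) \<and>
     continuous_on {a..b} \<psi>' \<and> integral {a..b} \<psi> = 0"

lemma test_functionD:
  assumes "test_function a b \<psi> \<psi>'"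
  shows "t \<in> {a..b} \<Longrightarrow> (\<psi> has_vector_derivative \<psi>' t) (at t within {a..b})"
    "continuous_on {a..b} \<psi>'" "continuous_on {a..b} \<psi>" "integral {a..b} \<psi> = 0"
proof -
  show d: "(\<psi> has_vector_derivative \<psi>' t) (at t within {a..b})" if "t \<in> {a..b}" for t
    using assms that by (simp add: test_function_def)
  then show "continuous_on {a..b} \<psi>"
    using has_vector_derivative_continuous continuous_on_eq_continuous_within by blast
qed (use assms in \<open>auto simp: test_function_def\<close>)

lemma test_function_primitive:
  assumes "test_function a b \<psi> \<psi>'" "a < b"
  obtains \<phi> where "\<And>t. t \<in> {a..b} \<Longrightarrow> (\<phi> has_vector_derivative \<psi> t) (at t within {a..b})"
    "\<phi> a = 0" "\<phi> b = 0" "continuous_on {a..b} \<phi>"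
proof
  note \<psi> = test_functionD[OF assms(1)]
  show d: "((\<lambda>t. integral {a..t} \<psi>) has_vector_derivative \<psi> t) (at t within {a..b})" if "t \<in> {a..b}" for t
    using that \<psi>(3) by (rule integral_has_vector_derivative[rotated])
  then show "continuous_on {a..b} (\<lambda>t. integral {a..t} \<psi>)"
    using has_vector_derivative_continuous continuous_on_eq_continuous_within by blast
qed (use test_functionD[OF assms(1)] in auto)

text \<open>
  Subtract from \<open>F\<close> the affine function \<open>A\<close> with the same end values. The difference \<open>Q\<close> is
  continuous, so its primitive, normalised to mean value zero, is an admissible test function,
  and the pairing with it reduces to the integral of \<open>- \<bar>Q\<bar>\<^sup>2\<close>.
\<close>

lemma du_bois_reymond:
  fixes F :: "real \<Rightarrow> 'a::euclidean_space"
  assumes "a < b" and F: "continuous_on {a..b} F"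
    and weak: "\<And>\<psi> \<psi>'. test_function a b \<psi> \<psi>' \<Longrightarrow> weak_pairing a b F \<psi> \<psi>' = 0"
  shows "\<exists>c. \<forall>t\<in>{a..b}. F t = F a + (t - a) *\<^sub>R c"
proof -
  define c where "c = (F b - F a) /\<^sub>R (b - a)"
  define A where "A t = F a + (t - a) *\<^sub>R c" for t
  define Q where "Q t = F t - A t" for t
  define \<Psi> where "\<Psi> t = integral {a..t} Q" for t
  define \<psi> where "\<psi> t = \<Psi> t - integral {a..b} \<Psi> /\<^sub>R (b - a)" for t
  have Q: "continuous_on {a..b} Q"
    unfolding Q_def A_def by (intro continuous_intros F)
  have A: "continuous_on {a..b} A"
    unfolding A_def by (intro continuous_intros)
  have d\<Psi>: "(\<Psi> has_vector_derivative Q t) (at t within {a..b})" if "t \<in> {a..b}" for t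
    unfolding \<Psi>_def using that Q by (rule integral_has_vector_derivative[rotated])
  then have d\<psi>: "(\<psi> has_vector_derivative Q t) (at t within {a..b})" if "t \<in> {a..b}" for t
    unfolding \<psi>_def using that by (auto intro!: derivative_eq_intros)
  have \<Psi>: "continuous_on {a..b} \<Psi>"
    using d\<Psi> has_vector_derivative_continuous continuous_on_eq_continuous_within by blast
  have \<psi>: "continuous_on {a..b} \<psi>"
    using d\<psi> has_vector_derivative_continuous continuous_on_eq_continuous_within by blast
  have int0: "integral {a..b} \<psi> = 0"
    using \<open>a < b\<close> integrable_continuous_real[OF \<Psi>] unfolding \<psi>_def
    by (subst integral_diff) auto
  have "weak_pairing a b F \<psi> Q = 0"
    by (rule weak) (simp add: test_function_def d\<psi> Q int0)
  moreover have "((\<lambda>t. A t \<bullet> Q t + c \<bullet> \<psi> t) has_integral A b \<bullet> \<psi> b - A a \<bullet> \<psi> a) {a..b}"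
  proof (rule fundamental_theorem_of_calculus)
    fix t assume "t \<in> {a..b}"
    moreover have "(A has_vector_derivative c) (at t within {a..b})"
      unfolding A_def by (auto intro!: derivative_eq_intros)
    ultimately show "((\<lambda>t. A t \<bullet> \<psi> t) has_vector_derivative A t \<bullet> Q t + c \<bullet> \<psi> t) (at t within {a..b})"
      by (intro bounded_bilinear.has_vector_derivative[OF bounded_bilinear_inner] d\<psi>)
  qed (use \<open>a < b\<close> in auto)
  then have "integral {a..b} (\<lambda>t. A t \<bullet> Q t + c \<bullet> \<psi> t) = A b \<bullet> \<psi> b - A a \<bullet> \<psi> a"
    by (rule integral_unique)
  moreover have "integral {a..b} (\<lambda>t. A t \<bullet> Q t + c \<bullet> \<psi> t) = integral {a..b} (\<lambda>t. A t \<bullet> Q t) + c \<bullet> integral {a..b} \<psi>"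
  proof (subst integral_add)
    show "(\<lambda>t. A t \<bullet> Q t) integrable_on {a..b}" "(\<lambda>t. c \<bullet> \<psi> t) integrable_on {a..b}"
      by (intro integrable_continuous_real continuous_intros A Q \<psi>)+
    have "integral {a..b} (\<lambda>t. c \<bullet> \<psi> t) = c \<bullet> integral {a..b} \<psi>"
      using integral_linear[OF integrable_continuous_real[OF \<psi>] bounded_linear_inner_right]
      by (simp add: o_def)
    then show "integral {a..b} (\<lambda>t. A t \<bullet> Q t) + integral {a..b} (\<lambda>t. c \<bullet> \<psi> t) =
        integral {a..b} (\<lambda>t. A t \<bullet> Q t) + c \<bullet> integral {a..b} \<psi>"
      by (rule arg_cong)
  qed
  moreover have "integral {a..b} (\<lambda>t. F t \<bullet> Q t) = integral {a..b} (\<lambda>t. A t \<bullet> Q t) + integral {a..b} (\<lambda>t. Q t \<bullet> Q t)"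
  proof -
    have "F t = A t + Q t" for t
      by (simp add: Q_def)
    then have "(\<lambda>t. F t \<bullet> Q t) = (\<lambda>t. A t \<bullet> Q t + Q t \<bullet> Q t)"
      by (simp only: inner_add_left)
    then show ?thesis
      by (simp only:) (intro integral_add integrable_continuous_real continuous_intros A Q)
  qed
  moreover have "A b = F b" "A a = F a"
    using \<open>a < b\<close> by (auto simp: A_def c_def)
  ultimately have "integral {a..b} (\<lambda>t. Q t \<bullet> Q t) = 0"
    by (simp add: weak_pairing_def int0)
  moreover have cQ: "continuous_on {a..b} (\<lambda>t. Q t \<bullet> Q t)"
    by (intro continuous_intros Q)
  ultimately have "((\<lambda>t. Q t \<bullet> Q t) has_integral 0) {a..b}"
    by (metis integrable_continuous_real integrable_integral)
  then have "Q t \<bullet> Q t = 0" if "t \<in> {a..b}" for t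
    using has_integral_0_cbox_imp_0[of a b "\<lambda>t. Q t \<bullet> Q t" t] cQ that \<open>a < b\<close> by auto
  then have "Q t = 0" if "t \<in> {a..b}" for t
    using that by (metis inner_eq_zero_iff)
  then have "F t = F a + (t - a) *\<^sub>R c" if "t \<in> {a..b}" for t
    using that unfolding Q_def A_def by (metis eq_iff_diff_eq_0)
  then show ?thesis by blast
qed

lemma weak_pairing_primitive:
  fixes F :: "real \<Rightarrow> 'a::euclidean_space"
  assumes "a \<le> b" and F: "\<And>t. t \<in> {a..b} \<Longrightarrow> (F has_vector_derivative f t) (at t within {a..b})"
    and f: "continuous_on {a..b} f" and \<psi>: "test_function a b \<psi> \<psi>'"
  shows "weak_pairing a b F \<psi> \<psi>' = integral {a..b} (\<lambda>t. f t \<bullet> \<psi> t)"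
proof -
  note \<psi> = test_functionD[OF \<psi>]
  have cF: "continuous_on {a..b} F"
    using F has_vector_derivative_continuous continuous_on_eq_continuous_within by blast
  have "((\<lambda>t. F t \<bullet> \<psi>' t + f t \<bullet> \<psi> t) has_integral (F b \<bullet> \<psi> b - F a \<bullet> \<psi> a)) {a..b}"
    by (intro fundamental_theorem_of_calculus bounded_bilinear.has_vector_derivative[OF bounded_bilinear_inner] F \<psi> \<open>a \<le> b\<close>)
  then have "integral {a..b} (\<lambda>t. F t \<bullet> \<psi>' t + f t \<bullet> \<psi> t) = F b \<bullet> \<psi> b - F a \<bullet> \<psi> a"
    by (rule integral_unique)
  moreover have "integral {a..b} (\<lambda>t. F t \<bullet> \<psi>' t + f t \<bullet> \<psi> t) =
      integral {a..b} (\<lambda>t. F t \<bullet> \<psi>' t) + integral {a..b} (\<lambda>t. f t \<bullet> \<psi> t)"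
    by (intro integral_add integrable_continuous_real continuous_intros f cF \<psi>)
  ultimately show ?thesis by (simp add: weak_pairing_def)
qed

text \<open>
  If every test function were orthogonal to \<open>x\<close>, the primitive of \<open>x\<close> would be affine.
\<close>

lemma exists_test_function_detecting:
  fixes x :: "real \<Rightarrow> real"
  assumes "a < b" and x: "continuous_on {a..b} x" and nonconst: "\<not> (\<exists>c. \<forall>t\<in>{a..b}. x t = c)"
  obtains z z' where "test_function a b z z'" "integral {a..b} (\<lambda>t. x t * z t) \<noteq> 0"
proof (rule ccontr)
  assume "\<not> thesis"
  with that have orth: "integral {a..b} (\<lambda>t. x t * z t) = 0" if "test_function a b z z'" for z z'
    using that by blast
  define F where "F t = integral {a..t} x" for t
  have F: "(F has_vector_derivative x t) (at t within {a..b})" if "t \<in> {a..b}" for t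
    unfolding F_def using that x by (rule integral_has_vector_derivative[rotated])
  then have cF: "continuous_on {a..b} F"
    using has_vector_derivative_continuous continuous_on_eq_continuous_within by blast
  have "\<exists>c. \<forall>t\<in>{a..b}. F t = F a + (t - a) *\<^sub>R c"
  proof (rule du_bois_reymond[OF \<open>a < b\<close> cF])
    fix \<psi> \<psi>' :: "real \<Rightarrow> real"
    assume "test_function a b \<psi> \<psi>'"
    then show "weak_pairing a b F \<psi> \<psi>' = 0"
      using weak_pairing_primitive[OF _ F x] orth \<open>a < b\<close> by simp
  qed
  then obtain c where c: "\<And>t. t \<in> {a..b} \<Longrightarrow> F t = F a + (t - a) *\<^sub>R c"
    by blast
  have "x t = c" if t: "t \<in> {a..b}" for t
  proof -
    have "((\<lambda>t. F a + (t - a) *\<^sub>R c) has_vector_derivative c) (at t within {a..b})"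
      by (auto intro!: derivative_eq_intros)
    then have "(F has_vector_derivative c) (at t within {a..b})"
      using has_vector_derivative_transform[OF t, of F "\<lambda>t. F a + (t - a) *\<^sub>R c"] c by blast
    with F[OF t] show ?thesis
      using vector_derivative_within_closed_interval[OF \<open>a < b\<close> t] by metis
  qed
  with nonconst show False by blast
qed

lemma (in bounded_linear) lipschitz_on_image:
  assumes "K-lipschitz_on S g"
  shows "\<exists>M. M-lipschitz_on S (\<lambda>t. f (g t))"
proof -
  obtain B where "B-lipschitz_on (g ` S) f"
    using lipschitz_boundE[of "g ` S"] by blast
  then show ?thesis using lipschitz_on_compose2[OF assms] by blast
qed

lemma (in bounded_bilinear) lipschitz_on_Icc:
  fixes f :: "real \<Rightarrow> 'a" and g :: "real \<Rightarrow> 'b"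
  assumes f: "K-lipschitz_on {a..b} f" and g: "M-lipschitz_on {a..b} g"
  shows "\<exists>C. C-lipschitz_on {a..b} (\<lambda>t. prod (f t) (g t))"
proof -
  obtain B where B: "B > 0" "\<And>u v. norm (prod u v) \<le> norm u * norm v * B"
    using pos_bounded by blast
  have "bounded (f ` {a..b})" "bounded (g ` {a..b})"
    by (intro compact_imp_bounded compact_continuous_image lipschitz_on_continuous_on[OF f]
        lipschitz_on_continuous_on[OF g] compact_Icc)+
  then obtain P R where P: "\<And>t. t \<in> {a..b} \<Longrightarrow> norm (f t) \<le> P" "P > 0"
    and R: "\<And>t. t \<in> {a..b} \<Longrightarrow> norm (g t) \<le> R" "R > 0"
    unfolding bounded_pos by (metis imageI)
  have K: "K \<ge> 0" and M: "M \<ge> 0"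
    using f g lipschitz_on_nonneg by auto
  show ?thesis
  proof (intro exI lipschitz_onI)
    fix s t assume st: "s \<in> {a..b}" "t \<in> {a..b}"
    have "prod (f s) (g s) - prod (f t) (g t) = prod (f s - f t) (g s) + prod (f t) (g s - g t)"
      by (simp add: diff_left diff_right)
    then have "norm (prod (f s) (g s) - prod (f t) (g t)) \<le> norm (f s - f t) * norm (g s) * B + norm (f t) * norm (g s - g t) * B"
      by (metis B(2) add_mono norm_triangle_le)
    also have "\<dots> \<le> (K * norm (s - t)) * R * B + P * (M * norm (s - t)) * B"
      using st B(1) P R K M lipschitz_on_normD[OF f st] lipschitz_on_normD[OF g st]
      by (intro add_mono mult_right_mono mult_mono) (auto intro: less_imp_le)
    finally show "dist (prod (f s) (g s)) (prod (f t) (g t)) \<le> (K * R * B + P * M * B) * dist s t"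
      by (simp add: dist_norm algebra_simps)
  qed (use K M B(1) P(2) R(2) in auto)
qed

lemma C1_imp_lipschitz_on_Icc:
  fixes f :: "real \<Rightarrow> 'a::real_normed_vector"
  assumes d: "\<And>t. t \<in> {a..b} \<Longrightarrow> (f has_vector_derivative f' t) (at t within {a..b})"
    and "continuous_on {a..b} f'"
  shows "\<exists>L. L-lipschitz_on {a..b} f"
proof -
  have "bounded (f' ` {a..b})"
    by (intro compact_imp_bounded compact_continuous_image assms compact_Icc)
  then obtain P where P: "\<And>t. t \<in> {a..b} \<Longrightarrow> norm (f' t) \<le> P" "P > 0"
    unfolding bounded_pos by (metis imageI)
  have "P-lipschitz_on {a..b} f"
  proof (rule bounded_derivative_imp_lipschitz)
    show "(f has_derivative (\<lambda>h. h *\<^sub>R f' t)) (at t within {a..b})" if "t \<in> {a..b}" for t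
      using d[OF that] by (simp add: has_vector_derivative_def)
    show "onorm (\<lambda>h. h *\<^sub>R f' t) \<le> P" if "t \<in> {a..b}" for t
      using P(1)[OF that] P(2) by (intro onorm_le) (simp add: mult.commute[of _ "norm (f' _)"] mult_right_mono)
  qed (use P in auto)
  then show ?thesis ..
qed

section \<open>The planar path of a horizontal curve\<close>

text \<open>
  A horizontal curve \<open>(x, \<ell>, y)\<close> is determined by its path \<open>p = (x, \<ell>)\<close> and its starting
  point, because \<open>y' = area_form p p' / 2\<close>; its sub-Riemannian length is the Euclidean length
  of \<open>p\<close>. The increments of the three components of \<open>y\<close> are the signed areas swept by the position
  vector \<open>p\<close> in the planes of the coordinates \<open>x\<close> and \<open>\<ell>\<^sub>i\<close>.
\<close>

definition planar :: "carnot \<Rightarrow> real \<times> (real^3)" where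
  "planar c = (fst c, fst (snd c))"

definition area_form :: "real \<times> (real^3) \<Rightarrow> real \<times> (real^3) \<Rightarrow> real^3" where
  "area_form p q = fst p *\<^sub>R snd q - fst q *\<^sub>R snd p"

lemma bounded_linear_planar: "bounded_linear planar"
  unfolding planar_def
  by (intro bounded_linear_Pair bounded_linear_fst bounded_linear_fst_comp bounded_linear_snd)

interpretation area: bounded_bilinear area_form
proof -
  have "bilinear area_form"
    unfolding bilinear_def area_form_def by (auto intro!: linearI simp: algebra_simps)
  then show "bounded_bilinear area_form"
    by (simp add: bilinear_conv_bounded_bilinear)
qed

lemma area_form_flip: "area_form p q = - area_form q p"
  by (simp add: area_form_def)

lemma frame_comb_area_form: "frame_comb c u = (fst u, snd u, (1/2) *\<^sub>R area_form (planar c) u)"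
  by (cases c; cases u) (simp add: frame_comb_eq planar_def area_form_def)

lemma sr_norm_frame_comb: "sr_norm c (frame_comb c u) = norm u"
  by (simp add: sr_norm_def sr_metric_def norm_eq_sqrt_inner)

lemma planar_frame_comb: "planar (frame_comb c u) = u"
  by (simp add: planar_def frame_comb_area_form)

lemma sr_speed:
  assumes "(c has_vector_derivative frame_comb (c t) u) (at t within {a..b})" "a < b" "t \<in> {a..b}"
  shows "sr_norm (c t) (vector_derivative c (at t within {a..b})) = norm u"
  using assms vector_derivative_within_cbox[of a b t c] by (simp add: sr_norm_frame_comb)

text \<open>
  The function \<open>f\<close> will be the speed of a competitor. A nonintegrable function has integral 0 by
  convention, which is also below \<open>I\<close>; this is why the bound \<open>0 \<le> f\<close> is there.
\<close>

lemma integral_le_off_negligible: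
  fixes f h :: "real \<Rightarrow> real"
  assumes N: "negligible N" and h: "(h has_integral I) S"
    and le: "\<And>t. t \<in> S - N \<Longrightarrow> 0 \<le> f t \<and> f t \<le> h t"
  shows "integral S f \<le> I"
proof -
  define h' where "h' t = (if t \<in> N then 0 else h t)" for t
  define f' where "f' t = (if t \<in> N then 0 else f t)" for t
  have h': "(h' has_integral I) S"
    by (rule has_integral_spike[OF N _ h]) (simp add: h'_def)
  have ff: "integral S f = integral S f'"
    by (rule integral_spike[OF N]) (simp add: f'_def)
  show ?thesis
  proof (cases "f' integrable_on S")
    case True
    then show ?thesis unfolding ff
      by (rule has_integral_le[OF integrable_integral h']) (use le in \<open>auto simp: f'_def h'_def\<close>)
  next
    case False
    have "0 \<le> I"
      by (rule has_integral_nonneg[OF h']) (use le in \<open>force simp: h'_def\<close>)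
    then show ?thesis unfolding ff using False by (simp add: not_integrable_integral)
  qed
qed

text \<open>
  Deform the planar path \<open>p\<close> to \<open>p + \<phi>\<close>. The deformed path lifts to a horizontal curve whose
  vertical part is explicit (\<open>Z\<close> below), and the lift ends at the same point exactly when the
  area condition holds. Comparing lengths through \<open>\<bar>v\<bar> \<le> (\<bar>v\<bar>\<^sup>2 + s\<^sup>2) / (2 * s)\<close>, which is an
  equality on the minimizer, turns minimality of length into an inequality between energies.
\<close>

lemma minimizer_first_variation:
  fixes \<gamma> :: "real \<Rightarrow> carnot" and \<phi> \<phi>1 \<phi>2 u :: "real \<Rightarrow> real \<times> (real^3)"
  assumes "a < b" and min: "length_minimizer \<gamma> a b" and "0 < s" and N: "negligible N"
    and vel: "\<And>t. t \<in> {a..b} - N \<Longrightarrow>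
      (\<gamma> has_vector_derivative frame_comb (\<gamma> t) (u t)) (at t within {a..b})"
    and speed: "\<And>t. t \<in> {a..b} - N \<Longrightarrow> norm (u t) = s"
    and d\<phi>: "\<And>t. t \<in> {a..b} \<Longrightarrow> (\<phi> has_vector_derivative \<phi>1 t) (at t within {a..b})"
    and d\<phi>1: "\<And>t. t \<in> {a..b} \<Longrightarrow> (\<phi>1 has_vector_derivative \<phi>2 t) (at t within {a..b})"
    and \<phi>2: "continuous_on {a..b} \<phi>2" and ends: "\<phi> a = 0" "\<phi> b = 0"
    and area0: "integral {a..b} (\<lambda>t. area_form (planar (\<gamma> t) + (1/2) *\<^sub>R \<phi> t) (\<phi>1 t)) = 0"
  shows "0 \<le> 2 * weak_pairing a b (\<lambda>t. planar (\<gamma> t)) \<phi>1 \<phi>2 + integral {a..b} (\<lambda>t. \<phi>1 t \<bullet> \<phi>1 t)"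
proof -
  define p where "p t = planar (\<gamma> t)" for t
  define G where "G t = area_form (p t + (1/2) *\<^sub>R \<phi> t) (\<phi>1 t)" for t
  \<comment> \<open>The change of the vertical coordinate caused by \<open>\<phi>\<close> is half the integral of
    \<open>area_form p \<phi>1 + area_form \<phi> p' + area_form \<phi> \<phi>1\<close>. Partial integration moves the
    derivative off \<open>p\<close>, which is only Lipschitz, so that \<open>Z\<close> is differentiable wherever \<open>p\<close> is.\<close>
  define Z where "Z t = (1/2) *\<^sub>R area_form (\<phi> t) (p t) + integral {a..t} G" for t
  define c where "c t = \<gamma> t + (fst (\<phi> t), snd (\<phi> t), Z t)" for t
  obtain L where lip\<gamma>: "L-lipschitz_on {a..b} \<gamma>"
    using min by (auto simp: length_minimizer_def admissible_on_def)
  obtain K where lipp: "K-lipschitz_on {a..b} p"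
    unfolding p_def using bounded_linear.lipschitz_on_image[OF bounded_linear_planar lip\<gamma>] by blast
  have \<phi>1: "continuous_on {a..b} \<phi>1"
    using d\<phi>1 has_vector_derivative_continuous continuous_on_eq_continuous_within by blast
  have \<phi>: "continuous_on {a..b} \<phi>"
    using d\<phi> has_vector_derivative_continuous continuous_on_eq_continuous_within by blast
  have p: "continuous_on {a..b} p"
    by (rule lipschitz_on_continuous_on[OF lipp])
  have G: "continuous_on {a..b} G"
    unfolding G_def by (intro area.continuous_on continuous_intros p \<phi> \<phi>1)
  have dG: "((\<lambda>t. integral {a..t} G) has_vector_derivative G t) (at t within {a..b})" if "t \<in> {a..b}" for t
    using that G by (rule integral_has_vector_derivative[rotated])
  obtain K1 K2 K3 where lip\<phi>: "K1-lipschitz_on {a..b} \<phi>" and lip\<phi>1: "K2-lipschitz_on {a..b} \<phi>1"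
    and lipG: "K3-lipschitz_on {a..b} (\<lambda>t. integral {a..t} G)"
    using C1_imp_lipschitz_on_Icc[OF d\<phi> \<phi>1] C1_imp_lipschitz_on_Icc[OF d\<phi>1 \<phi>2]
      C1_imp_lipschitz_on_Icc[OF dG G] by blast
  obtain K4 where lipA: "K4-lipschitz_on {a..b} (\<lambda>t. area_form (\<phi> t) (p t))"
    using area.lipschitz_on_Icc[OF lip\<phi> lipp] by blast
  have planar_c: "planar (c t) = p t + \<phi> t" for t
    by (simp add: c_def planar_def p_def prod_eq_iff)

  have lipc: "\<exists>L. L-lipschitz_on {a..b} c"
  proof -
    obtain M1 M2 where M: "M1-lipschitz_on {a..b} (\<lambda>t. fst (\<phi> t))" "M2-lipschitz_on {a..b} (\<lambda>t. snd (\<phi> t))"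
      using bounded_linear.lipschitz_on_image[OF bounded_linear_fst lip\<phi>]
        bounded_linear.lipschitz_on_image[OF bounded_linear_snd lip\<phi>] by blast
    show ?thesis
      unfolding c_def Z_def by (rule exI, rule lipschitz_on_add[OF lip\<gamma>],
          rule lipschitz_on_Pair[OF M(1) lipschitz_on_Pair[OF M(2) lipschitz_on_add[OF lipschitz_on_cmult[OF lipA] lipG]]])
  qed
  have dp: "(p has_vector_derivative u t) (at t within {a..b})" if "t \<in> {a..b} - N" for t
    using bounded_linear.has_vector_derivative[OF bounded_linear_planar vel[OF that]]
    by (simp add: p_def[abs_def] planar_frame_comb)
  have dc: "(c has_vector_derivative frame_comb (c t) (u t + \<phi>1 t)) (at t within {a..b})"
    if t: "t \<in> {a..b} - N" for t
  proof -
    have "(Z has_vector_derivative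
        (1/2) *\<^sub>R (area_form (\<phi> t) (u t) + area_form (\<phi>1 t) (p t)) + G t) (at t within {a..b})"
      unfolding Z_def using t
      by (intro has_vector_derivative_add dG area.has_vector_derivative d\<phi> dp
          bounded_linear.has_vector_derivative[OF bounded_linear_scaleR_right]) auto
    then have "(c has_vector_derivative frame_comb (\<gamma> t) (u t) + (fst (\<phi>1 t), snd (\<phi>1 t),
        (1/2) *\<^sub>R (area_form (\<phi> t) (u t) + area_form (\<phi>1 t) (p t)) + G t)) (at t within {a..b})"
      unfolding c_def using t
      by (intro has_vector_derivative_add vel has_vector_derivative_Pair d\<phi>
        bounded_linear.has_vector_derivative[OF bounded_linear_fst]
        bounded_linear.has_vector_derivative[OF bounded_linear_snd]) auto
    moreover have "frame_comb (\<gamma> t) (u t) + (fst (\<phi>1 t), snd (\<phi>1 t),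
        (1/2) *\<^sub>R (area_form (\<phi> t) (u t) + area_form (\<phi>1 t) (p t)) + G t) = frame_comb (c t) (u t + \<phi>1 t)"
      unfolding frame_comb_area_form planar_c G_def p_def[symmetric]
      by (simp add: area.add_left area.add_right area.scaleR_left area_form_flip[of "\<phi>1 t" "p t"] vec_eq_iff field_simps)
    ultimately show ?thesis by simp
  qed
  have AE_N: "AE t in lebesgue. t \<notin> N"
    using N by (simp add: negligible_iff_null_sets AE_not_in)
  have "admissible_on {a..b} c"
    unfolding admissible_on_def distribution_eq_range
  proof (rule conjI[OF lipc], use AE_N in eventually_elim, intro impI)
    fix t assume "t \<notin> N" "t \<in> {a..b}"
    then show "\<exists>v\<in>range (frame_comb (c t)). (c has_vector_derivative v) (at t within {a..b})"
      using dc[of t] by blast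
  qed
  moreover have "c a = \<gamma> a" "c b = \<gamma> b"
    using area0 by (simp_all add: c_def Z_def ends area.zero_left G_def[abs_def] p_def flip: zero_prod_def)
  ultimately have le: "sr_length \<gamma> a b \<le> sr_length c a b"
    using min \<open>a < b\<close> by (auto simp: length_minimizer_def)

  have "sr_length \<gamma> a b = integral {a..b} (\<lambda>t. s)"
    unfolding sr_length_def
    by (rule integral_spike[OF N]) (simp add: sr_speed[OF vel, unfolded Diff_iff] speed \<open>a < b\<close>)
  then have len\<gamma>: "sr_length \<gamma> a b = s * (b - a)"
    using \<open>a < b\<close> by simp

  have pair: "((\<lambda>t. u t \<bullet> \<phi>1 t) has_integral weak_pairing a b p \<phi>1 \<phi>2) {a..b}"
  proof -
    obtain M where "M-lipschitz_on {a..b} (\<lambda>t. p t \<bullet> \<phi>1 t)"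
      using bounded_bilinear.lipschitz_on_Icc[OF bounded_bilinear_inner lipp lip\<phi>1] by blast
    then have "((\<lambda>t. p t \<bullet> \<phi>2 t + u t \<bullet> \<phi>1 t) has_integral (p b \<bullet> \<phi>1 b - p a \<bullet> \<phi>1 a)) {a..b}"
      using \<open>a < b\<close> by (intro lipschitz_fundamental_theorem[OF _ _ N]
          bounded_bilinear.has_vector_derivative[OF bounded_bilinear_inner] dp d\<phi>1) auto
    moreover have "((\<lambda>t. p t \<bullet> \<phi>2 t) has_integral integral {a..b} (\<lambda>t. p t \<bullet> \<phi>2 t)) {a..b}"
      by (intro integrable_integral integrable_continuous_real continuous_intros p \<phi>2)
    ultimately have "((\<lambda>t. (p t \<bullet> \<phi>2 t + u t \<bullet> \<phi>1 t) - p t \<bullet> \<phi>2 t) has_integral weak_pairing a b p \<phi>1 \<phi>2) {a..b}"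
      unfolding weak_pairing_def by (rule has_integral_diff)
    then show ?thesis by simp
  qed
  have "((\<lambda>t. \<phi>1 t \<bullet> \<phi>1 t) has_integral integral {a..b} (\<lambda>t. \<phi>1 t \<bullet> \<phi>1 t)) {a..b}"
    by (intro integrable_integral integrable_continuous_real continuous_intros \<phi>1)
  moreover have "((\<lambda>t. 2 * s\<^sup>2) has_integral (2 * s\<^sup>2 * (b - a))) {a..b}"
    using has_integral_const_real[of "2 * s\<^sup>2" a b] \<open>a < b\<close> by (simp add: mult.commute)
  ultimately
  have "((\<lambda>t. (2 * s\<^sup>2 + 2 * (u t \<bullet> \<phi>1 t) + \<phi>1 t \<bullet> \<phi>1 t) / (2 * s)) has_integral
      ((2 * s\<^sup>2 * (b - a) + 2 * weak_pairing a b p \<phi>1 \<phi>2 + integral {a..b} (\<lambda>t. \<phi>1 t \<bullet> \<phi>1 t)) / (2 * s))) {a..b}"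
    by (intro has_integral_divide has_integral_add has_integral_mult_right pair)
  then have "sr_length c a b \<le> (2 * s\<^sup>2 * (b - a) + 2 * weak_pairing a b p \<phi>1 \<phi>2 + integral {a..b} (\<lambda>t. \<phi>1 t \<bullet> \<phi>1 t)) / (2 * s)"
    unfolding sr_length_def
  proof (rule integral_le_off_negligible[OF N])
    fix t assume t: "t \<in> {a..b} - N"
    have "sr_norm (c t) (vector_derivative c (at t within {a..b})) = norm (u t + \<phi>1 t)"
      using t \<open>a < b\<close> by (intro sr_speed[OF dc]) auto
    moreover have "norm (u t + \<phi>1 t) \<le> (2 * s\<^sup>2 + 2 * (u t \<bullet> \<phi>1 t) + \<phi>1 t \<bullet> \<phi>1 t) / (2 * s)"
    proof -
      have "0 \<le> (norm (u t + \<phi>1 t) - s)\<^sup>2" by simp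
      moreover have "(norm (u t + \<phi>1 t))\<^sup>2 = s\<^sup>2 + 2 * (u t \<bullet> \<phi>1 t) + \<phi>1 t \<bullet> \<phi>1 t"
        using speed[OF t] by (simp add: power2_norm_eq_inner inner_add_left inner_add_right inner_commute flip: speed[OF t])
      ultimately show ?thesis
        using \<open>0 < s\<close> by (simp add: power2_diff field_simps power2_eq_square)
    qed
    ultimately show "0 \<le> sr_norm (c t) (vector_derivative c (at t within {a..b})) \<and>
        sr_norm (c t) (vector_derivative c (at t within {a..b})) \<le>
          (2 * s\<^sup>2 + 2 * (u t \<bullet> \<phi>1 t) + \<phi>1 t \<bullet> \<phi>1 t) / (2 * s)"
      by simp
  qed
  then have "s * (b - a) \<le> (2 * s\<^sup>2 * (b - a) + 2 * weak_pairing a b p \<phi>1 \<phi>2 + integral {a..b} (\<lambda>t. \<phi>1 t \<bullet> \<phi>1 t)) / (2 * s)"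
    using le len\<gamma> by linarith
  then have "s * (b - a) * (2 * s) \<le> 2 * s\<^sup>2 * (b - a) + 2 * weak_pairing a b p \<phi>1 \<phi>2 + integral {a..b} (\<lambda>t. \<phi>1 t \<bullet> \<phi>1 t)"
    using \<open>0 < s\<close> by (simp add: pos_le_divide_eq)
  then show ?thesis
    by (simp add: p_def[abs_def] power2_eq_square algebra_simps)
qed

section \<open>Lagrange multipliers for the area constraints\<close>

text \<open>
  The skew-symmetric generator of rotations in the plane spanned by the \<open>x\<close>-axis and \<open>\<mu>\<close>. It is
  the matrix of the form \<open>\<mu> \<bullet> area_form\<close> up to sign (lemma \<open>inner_area_form\<close>).
\<close>

definition rot :: "real^3 \<Rightarrow> real \<times> (real^3) \<Rightarrow> real \<times> (real^3)" where
  "rot \<mu> p = (\<mu> \<bullet> snd p, - fst p *\<^sub>R \<mu>)"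

lemma bounded_linear_rot: "bounded_linear (rot \<mu>)"
proof -
  have "linear (rot \<mu>)"
    by (rule linearI) (auto simp: rot_def algebra_simps)
  then show ?thesis by (simp add: linear_conv_bounded_linear)
qed

lemma inner_area_form: "\<mu> \<bullet> area_form p q = - (rot \<mu> p \<bullet> q)"
  by (simp add: area_form_def rot_def inner_prod_def algebra_simps)

text \<open>
  The equation says that \<open>p\<close> minus the primitive of \<open>rot \<mu> p\<close> annihilates all test functions, so
  this difference is affine. In particular \<open>p\<close>, a priori only Lipschitz, is continuously
  differentiable.
\<close>

lemma multiplier_equation_imp_ode:
  fixes p :: "real \<Rightarrow> real \<times> (real^3)"
  assumes "a < b" and p: "continuous_on {a..b} p"
    and eq: "\<And>\<psi> \<psi>'. test_function a b \<psi> \<psi>' \<Longrightarrow>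
      weak_pairing a b p \<psi> \<psi>' + \<mu> \<bullet> integral {a..b} (\<lambda>t. area_form (p t) (\<psi> t)) = 0"
  shows "\<exists>c. \<forall>t\<in>{a..b}. (p has_vector_derivative c + rot \<mu> (p t)) (at t within {a..b})"
proof -
  define R where "R t = integral {a..t} (\<lambda>t. rot \<mu> (p t))" for t
  have rp: "continuous_on {a..b} (\<lambda>t. rot \<mu> (p t))"
    by (rule bounded_linear.continuous_on[OF bounded_linear_rot p])
  have R: "(R has_vector_derivative rot \<mu> (p t)) (at t within {a..b})" if "t \<in> {a..b}" for t
    unfolding R_def using that rp by (rule integral_has_vector_derivative[rotated])
  then have cR: "continuous_on {a..b} R"
    using has_vector_derivative_continuous continuous_on_eq_continuous_within by blast
  define F where "F t = p t - R t" for t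
  have cF: "continuous_on {a..b} F"
    unfolding F_def by (intro continuous_intros p cR)
  have "\<exists>c. \<forall>t\<in>{a..b}. F t = F a + (t - a) *\<^sub>R c"
  proof (rule du_bois_reymond[OF \<open>a < b\<close> cF])
    fix \<psi> \<psi>' :: "real \<Rightarrow> real \<times> (real^3)"
    assume \<psi>: "test_function a b \<psi> \<psi>'"
    note \<psi>' = test_functionD[OF \<psi>]
    have "weak_pairing a b F \<psi> \<psi>' = weak_pairing a b p \<psi> \<psi>' - weak_pairing a b R \<psi> \<psi>'"
    proof -
      have "integral {a..b} (\<lambda>t. p t \<bullet> \<psi>' t - R t \<bullet> \<psi>' t) =
          integral {a..b} (\<lambda>t. p t \<bullet> \<psi>' t) - integral {a..b} (\<lambda>t. R t \<bullet> \<psi>' t)"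
        by (intro integral_diff integrable_continuous_real continuous_intros p cR \<psi>')
      then show ?thesis
        by (simp add: weak_pairing_def F_def inner_diff_left)
    qed
    also have "weak_pairing a b R \<psi> \<psi>' = integral {a..b} (\<lambda>t. rot \<mu> (p t) \<bullet> \<psi> t)"
      using \<open>a < b\<close> by (intro weak_pairing_primitive R rp \<psi>) auto
    also have "\<dots> = - integral {a..b} (\<lambda>t. \<mu> \<bullet> area_form (p t) (\<psi> t))"
      by (simp add: inner_area_form)
    also have "integral {a..b} (\<lambda>t. \<mu> \<bullet> area_form (p t) (\<psi> t)) = \<mu> \<bullet> integral {a..b} (\<lambda>t. area_form (p t) (\<psi> t))"
      using integral_linear[OF integrable_continuous_real[OF area.continuous_on[OF p \<psi>'(3)]] bounded_linear_inner_right]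
      by (simp add: o_def)
    finally show "weak_pairing a b F \<psi> \<psi>' = 0"
      using eq[OF \<psi>] by simp
  qed
  then obtain c where c: "\<And>t. t \<in> {a..b} \<Longrightarrow> F t = F a + (t - a) *\<^sub>R c"
    by blast
  show ?thesis
  proof (intro exI ballI)
    fix t assume t: "t \<in> {a..b}"
    have "((\<lambda>t. F a + (t - a) *\<^sub>R c + R t) has_vector_derivative c + rot \<mu> (p t)) (at t within {a..b})"
      using t by (auto intro!: derivative_eq_intros R)
    moreover have "p s = F a + (s - a) *\<^sub>R c + R s" if "s \<in> {a..b}" for s
      using c[OF that] by (simp add: F_def algebra_simps)
    ultimately show "(p has_vector_derivative c + rot \<mu> (p t)) (at t within {a..b})"
      using has_vector_derivative_transform[OF t, of p "\<lambda>t. F a + (t - a) *\<^sub>R c + R t"] by blast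
  qed
qed

text \<open>
  The outcome of the first variation, freed from the curve in the group: no variation of \<open>p\<close>
  that keeps the endpoints and the swept areas lowers the energy.
\<close>

definition area_constrained_minimal :: "real \<Rightarrow> real \<Rightarrow> (real \<Rightarrow> real \<times> (real^3)) \<Rightarrow> bool" where
  "area_constrained_minimal a b p \<longleftrightarrow>
     (\<forall>\<phi> \<psi> \<psi>'. (\<forall>t\<in>{a..b}. (\<phi> has_vector_derivative \<psi> t) (at t within {a..b})) \<and>
        \<phi> a = 0 \<and> \<phi> b = 0 \<and> test_function a b \<psi> \<psi>' \<and>
        integral {a..b} (\<lambda>t. area_form (p t + (1/2) *\<^sub>R \<phi> t) (\<psi> t)) = 0 \<longrightarrow>
        0 \<le> 2 * weak_pairing a b p \<psi> \<psi>' + integral {a..b} (\<lambda>t. \<psi> t \<bullet> \<psi> t))"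

lemma quadratic_nonneg_imp_linear_coeff_zero:
  fixes J A :: real
  assumes "\<And>\<epsilon>. 0 \<le> 2 * \<epsilon> * J + \<epsilon>\<^sup>2 * A"
  shows "J = 0"
proof (rule ccontr)
  assume "J \<noteq> 0"
  define \<epsilon> where "\<epsilon> = - J / (\<bar>A\<bar> + 1)"
  have "J = - (\<epsilon> * (\<bar>A\<bar> + 1))" by (simp add: \<epsilon>_def)
  moreover have "0 \<le> \<epsilon> * (2 * J + \<epsilon> * A)"
    using assms[of \<epsilon>] by (simp add: algebra_simps power2_eq_square)
  ultimately have "0 \<le> \<epsilon> * (2 * (- (\<epsilon> * (\<bar>A\<bar> + 1))) + \<epsilon> * A)"
    by simp
  also have "\<dots> = \<epsilon>\<^sup>2 * (A - 2 * (\<bar>A\<bar> + 1))"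
    by (simp add: algebra_simps power2_eq_square)
  finally have "0 \<le> \<epsilon>\<^sup>2 * (A - 2 * (\<bar>A\<bar> + 1))" .
  moreover have "\<epsilon>\<^sup>2 > 0" using \<open>J \<noteq> 0\<close> by (simp add: \<epsilon>_def)
  ultimately have "0 \<le> A - 2 * (\<bar>A\<bar> + 1)"
    by (simp add: zero_le_mult_iff)
  then show False using abs_ge_self[of A] abs_ge_zero[of A] by (simp add: algebra_simps)
qed

text \<open>
  The degenerate case: where \<open>x\<close> is constant, variations of \<open>\<ell>\<close> alone with fixed endpoints keep all
  swept areas. With respect to them the problem is unconstrained, so \<open>\<ell>\<close> moves on a straight line.
\<close>

lemma minimal_constant_fst_imp_ode:
  assumes "a < b" and p: "continuous_on {a..b} p" and min: "area_constrained_minimal a b p"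
    and x0: "\<And>t. t \<in> {a..b} \<Longrightarrow> fst (p t) = x0"
  shows "\<exists>c. \<forall>t\<in>{a..b}. (p has_vector_derivative c) (at t within {a..b})"
proof -
  define l where "l t = snd (p t)" for t
  have l: "continuous_on {a..b} l"
    unfolding l_def by (intro continuous_intros p)
  have "\<exists>c. \<forall>t\<in>{a..b}. l t = l a + (t - a) *\<^sub>R c"
  proof (rule du_bois_reymond[OF \<open>a < b\<close> l])
    fix \<psi> \<psi>' :: "real \<Rightarrow> real^3"
    assume \<psi>t: "test_function a b \<psi> \<psi>'"
    note \<psi> = test_functionD[OF \<psi>t]
    obtain \<phi> where \<phi>: "\<And>t. t \<in> {a..b} \<Longrightarrow> (\<phi> has_vector_derivative \<psi> t) (at t within {a..b})"
      "\<phi> a = 0" "\<phi> b = 0"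
      using test_function_primitive[OF \<psi>t \<open>a < b\<close>] by metis
    have "0 \<le> 2 * \<epsilon> * weak_pairing a b l \<psi> \<psi>' + \<epsilon>\<^sup>2 * integral {a..b} (\<lambda>t. \<psi> t \<bullet> \<psi> t)" for \<epsilon>
    proof -
      let ?\<phi> = "\<lambda>t. (0::real, \<epsilon> *\<^sub>R \<phi> t)" and ?\<psi> = "\<lambda>t. (0::real, \<epsilon> *\<^sub>R \<psi> t)" and ?\<psi>' = "\<lambda>t. (0::real, \<epsilon> *\<^sub>R \<psi>' t)"
      have d: "((\<lambda>t. (0::real, \<epsilon> *\<^sub>R f t)) has_vector_derivative (0, \<epsilon> *\<^sub>R f' t)) (at t within {a..b})"
        if "(f has_vector_derivative f' t) (at t within {a..b})" for f f' :: "real \<Rightarrow> real^3" and t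
        by (intro has_vector_derivative_Pair has_vector_derivative_const
            bounded_linear.has_vector_derivative[OF bounded_linear_scaleR_right] that)
      have i0: "integral {a..b} ?\<psi> = 0"
        using fundamental_theorem_of_calculus[of a b ?\<phi> ?\<psi>] d \<phi> \<open>a < b\<close>
        by (auto simp: integral_unique zero_prod_def)
      have "test_function a b ?\<psi> ?\<psi>'"
        unfolding test_function_def using \<psi> i0 by (auto intro!: d continuous_intros)
      moreover have "integral {a..b} (\<lambda>t. area_form (p t + (1/2) *\<^sub>R ?\<phi> t) (?\<psi> t)) = 0"
      proof -
        have "integral {a..b} (\<lambda>t. area_form (p t + (1/2) *\<^sub>R ?\<phi> t) (?\<psi> t)) = integral {a..b} (\<lambda>t. (x0 * \<epsilon>) *\<^sub>R \<psi> t)"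
          by (rule integral_cong) (simp add: area_form_def x0)
        then show ?thesis using \<psi> by simp
      qed
      ultimately have "0 \<le> 2 * weak_pairing a b p ?\<psi> ?\<psi>' + integral {a..b} (\<lambda>t. ?\<psi> t \<bullet> ?\<psi> t)"
        using min \<phi> d unfolding area_constrained_minimal_def
        by (elim allE[of _ ?\<phi>] allE[of _ ?\<psi>] allE[of _ ?\<psi>']) (auto simp: zero_prod_def)
      moreover have "weak_pairing a b p ?\<psi> ?\<psi>' = \<epsilon> * weak_pairing a b l \<psi> \<psi>'"
        by (simp add: weak_pairing_def l_def inner_prod_def algebra_simps)
      moreover have "integral {a..b} (\<lambda>t. ?\<psi> t \<bullet> ?\<psi> t) = \<epsilon>\<^sup>2 * integral {a..b} (\<lambda>t. \<psi> t \<bullet> \<psi> t)"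
        by (simp add: power2_eq_square mult.assoc)
      ultimately show ?thesis by (simp add: power2_eq_square)
    qed
    then show "weak_pairing a b l \<psi> \<psi>' = 0"
      by (rule quadratic_nonneg_imp_linear_coeff_zero)
  qed
  then obtain c where c: "\<And>t. t \<in> {a..b} \<Longrightarrow> l t = l a + (t - a) *\<^sub>R c" by blast
  show ?thesis
  proof (intro exI ballI)
    fix t assume t: "t \<in> {a..b}"
    have "((\<lambda>t. (x0, l a + (t - a) *\<^sub>R c)) has_vector_derivative (0, c)) (at t within {a..b})"
      by (auto intro!: derivative_eq_intros)
    moreover have "p s = (x0, l a + (s - a) *\<^sub>R c)" if "s \<in> {a..b}" for s
      using c[OF that] x0[OF that] by (simp add: l_def prod_eq_iff)
    ultimately show "(p has_vector_derivative (0, c)) (at t within {a..b})"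
      using has_vector_derivative_transform[OF t, of p "\<lambda>t. (x0, l a + (t - a) *\<^sub>R c)"] by blast
  qed
qed

text \<open>
  The Lagrange multiplier rule. Since \<open>x\<close> is not constant, some scalar test function \<open>z\<close> has
  \<open>m = \<integral> x z \<noteq> 0\<close>; adding \<open>z \<kappa>\<close> to the \<open>\<ell>\<close>-velocity then changes the three areas by \<open>m \<kappa>\<close> to
  first order, and so repairs any violation of the constraints. The areas are quadratic in the
  path, but two variations of \<open>\<ell>\<close> alone do not interact, so the equation for \<open>\<kappa>\<close> is linear and is
  solved exactly. The multiplier is \<open>- K / m\<close>, where \<open>\<kappa> \<bullet> K\<close> is the weak pairing of \<open>p\<close> with \<open>(0, z \<kappa>)\<close>.
\<close>

lemma minimal_imp_multiplier:
  assumes "a < b" and p: "continuous_on {a..b} p" and min: "area_constrained_minimal a b p"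
    and nonconst: "\<not> (\<exists>c. \<forall>t\<in>{a..b}. fst (p t) = c)"
  shows "\<exists>\<mu>. \<forall>\<psi> \<psi>'. test_function a b \<psi> \<psi>' \<longrightarrow>
      weak_pairing a b p \<psi> \<psi>' + \<mu> \<bullet> integral {a..b} (\<lambda>t. area_form (p t) (\<psi> t)) = 0"
proof -
  have cx: "continuous_on {a..b} (\<lambda>t. fst (p t))"
    by (intro continuous_intros p)
  obtain z z' where zt: "test_function a b z z'" and m0: "integral {a..b} (\<lambda>t. fst (p t) * z t) \<noteq> 0"
    using exists_test_function_detecting[OF \<open>a < b\<close> cx nonconst] by metis
  define m where "m = integral {a..b} (\<lambda>t. fst (p t) * z t)"
  note z = test_functionD[OF zt]
  obtain \<zeta> where \<zeta>: "\<And>t. t \<in> {a..b} \<Longrightarrow> (\<zeta> has_vector_derivative z t) (at t within {a..b})"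
    "\<zeta> a = 0" "\<zeta> b = 0" and c\<zeta>: "continuous_on {a..b} \<zeta>"
    using test_function_primitive[OF zt \<open>a < b\<close>] by metis
  define K where "K = z b *\<^sub>R snd (p b) - z a *\<^sub>R snd (p a) - integral {a..b} (\<lambda>t. z' t *\<^sub>R snd (p t))"
  define \<mu> where "\<mu> = - (1 / m) *\<^sub>R K"
  have ineq: "0 \<le> weak_pairing a b p \<psi> \<psi>' + \<mu> \<bullet> integral {a..b} (\<lambda>t. area_form (p t) (\<psi> t))"
    if \<psi>t: "test_function a b \<psi> \<psi>'" for \<psi> \<psi>'
  proof -
    note \<psi> = test_functionD[OF \<psi>t]
    obtain \<phi> where \<phi>: "\<And>t. t \<in> {a..b} \<Longrightarrow> (\<phi> has_vector_derivative \<psi> t) (at t within {a..b})"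
      "\<phi> a = 0" "\<phi> b = 0" and c\<phi>: "continuous_on {a..b} \<phi>"
      using test_function_primitive[OF \<psi>t \<open>a < b\<close>] by metis
    define J where "J = weak_pairing a b p \<psi> \<psi>'"
    define D where "D = integral {a..b} (\<lambda>t. area_form (p t) (\<psi> t))"
    define S where "S = integral {a..b} (\<lambda>t. area_form (\<phi> t) (\<psi> t))"
    define n where "n = integral {a..b} (\<lambda>t. (fst (\<phi> t) * z t - \<zeta> t * fst (\<psi> t)) / 2)"
    define A where "A = integral {a..b} (\<lambda>t. \<psi> t \<bullet> \<psi> t)"
    define B where "B = integral {a..b} (\<lambda>t. z t *\<^sub>R snd (\<psi> t))"
    define Z where "Z = integral {a..b} (\<lambda>t. z t * z t)"
    define k where "k \<epsilon> = (- 1 / (m + \<epsilon> * n)) *\<^sub>R (D + (\<epsilon> / 2) *\<^sub>R S)" for \<epsilon>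
    define h where "h \<epsilon> = 2 * (J + k \<epsilon> \<bullet> K) + \<epsilon> * (A + 2 * (k \<epsilon> \<bullet> B) + (k \<epsilon> \<bullet> k \<epsilon>) * Z)" for \<epsilon>
    have pos: "0 \<le> h \<epsilon>" if "\<epsilon> > 0" "m + \<epsilon> * n \<noteq> 0" for \<epsilon>
    proof -
      \<comment> \<open>The corrected variation \<open>\<Phi>\<close>, with velocity \<open>\<Psi> = \<epsilon> \<psi> + z (0, \<kappa>)\<close>; the choice of \<open>k\<close> is the
        solution of the linear equation that keeps the areas.\<close>
      define \<kappa> where "\<kappa> = \<epsilon> *\<^sub>R k \<epsilon>"
      define \<Phi> where "\<Phi> t = \<epsilon> *\<^sub>R \<phi> t + (0, \<zeta> t *\<^sub>R \<kappa>)" for t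
      define \<Psi> where "\<Psi> t = \<epsilon> *\<^sub>R \<psi> t + (0, z t *\<^sub>R \<kappa>)" for t
      define \<Psi>' where "\<Psi>' t = \<epsilon> *\<^sub>R \<psi>' t + (0, z' t *\<^sub>R \<kappa>)" for t
      have d: "((\<lambda>t. \<epsilon> *\<^sub>R f t + (0, g t *\<^sub>R \<kappa>)) has_vector_derivative \<epsilon> *\<^sub>R f' + (0, g' *\<^sub>R \<kappa>)) (at t within {a..b})"
        if "(f has_vector_derivative f') (at t within {a..b})" "(g has_vector_derivative g') (at t within {a..b})"
        for f :: "real \<Rightarrow> real \<times> (real^3)" and f' and g g' t
        by (intro has_vector_derivative_add has_vector_derivative_Pair has_vector_derivative_const
            bounded_linear.has_vector_derivative[OF bounded_linear_scaleR_right]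
            bounded_linear.has_vector_derivative[OF bounded_linear_scaleR_left] that)
      have d\<Phi>: "(\<Phi> has_vector_derivative \<Psi> t) (at t within {a..b})" if "t \<in> {a..b}" for t
        unfolding \<Phi>_def[abs_def] \<Psi>_def by (intro d \<phi> \<zeta> that)
      have d\<Psi>: "(\<Psi> has_vector_derivative \<Psi>' t) (at t within {a..b})" if "t \<in> {a..b}" for t
        unfolding \<Psi>_def[abs_def] \<Psi>'_def by (intro d \<psi> z that)
      have ends: "\<Phi> a = 0" "\<Phi> b = 0"
        using \<phi> \<zeta> by (simp_all add: \<Phi>_def zero_prod_def)
      have "(\<Psi> has_integral \<Phi> b - \<Phi> a) {a..b}"
        using \<open>a < b\<close> d\<Phi> by (intro fundamental_theorem_of_calculus) auto
      then have "integral {a..b} \<Psi> = 0"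
        by (simp add: ends integral_unique)
      moreover have "continuous_on {a..b} \<Psi>'"
        unfolding \<Psi>'_def by (intro continuous_intros \<psi> z)
      ultimately have test: "test_function a b \<Psi> \<Psi>'"
        by (simp add: test_function_def d\<Psi>)
      have "((\<lambda>t. \<epsilon> *\<^sub>R area_form (p t) (\<psi> t) + (fst (p t) * z t) *\<^sub>R \<kappa> + (\<epsilon>\<^sup>2 / 2) *\<^sub>R area_form (\<phi> t) (\<psi> t)
          + \<epsilon> *\<^sub>R ((fst (\<phi> t) * z t - \<zeta> t * fst (\<psi> t)) / 2) *\<^sub>R \<kappa>) has_integral
          \<epsilon> *\<^sub>R D + m *\<^sub>R \<kappa> + (\<epsilon>\<^sup>2 / 2) *\<^sub>R S + \<epsilon> *\<^sub>R n *\<^sub>R \<kappa>) {a..b}"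
        unfolding D_def m_def S_def n_def
        by (intro has_integral_add has_integral_cmul has_integral_scaleR_left integrable_integral
            integrable_continuous_real area.continuous_on continuous_intros p \<psi> c\<phi> c\<zeta> z) auto
      also have "(\<lambda>t. \<epsilon> *\<^sub>R area_form (p t) (\<psi> t) + (fst (p t) * z t) *\<^sub>R \<kappa> + (\<epsilon>\<^sup>2 / 2) *\<^sub>R area_form (\<phi> t) (\<psi> t)
          + \<epsilon> *\<^sub>R ((fst (\<phi> t) * z t - \<zeta> t * fst (\<psi> t)) / 2) *\<^sub>R \<kappa>) =
          (\<lambda>t. area_form (p t + (1/2) *\<^sub>R \<Phi> t) (\<Psi> t))"
        by (simp add: fun_eq_iff area_form_def \<Phi>_def \<Psi>_def vec_eq_iff field_simps power2_eq_square)
      also have "\<epsilon> *\<^sub>R D + m *\<^sub>R \<kappa> + (\<epsilon>\<^sup>2 / 2) *\<^sub>R S + \<epsilon> *\<^sub>R n *\<^sub>R \<kappa> = 0"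
      proof -
        have "(m + \<epsilon> * n) *\<^sub>R \<kappa> = - (\<epsilon> *\<^sub>R (D + (\<epsilon> / 2) *\<^sub>R S))"
          using that(2) by (simp add: \<kappa>_def k_def)
        then show ?thesis
          by (simp add: vec_eq_iff algebra_simps power2_eq_square)
      qed
      finally have "integral {a..b} (\<lambda>t. area_form (p t + (1/2) *\<^sub>R \<Phi> t) (\<Psi> t)) = 0"
        by (rule integral_unique)
      with min test d\<Phi> ends have "0 \<le> 2 * weak_pairing a b p \<Psi> \<Psi>' + integral {a..b} (\<lambda>t. \<Psi> t \<bullet> \<Psi> t)"
        unfolding area_constrained_minimal_def by blast
      moreover have "weak_pairing a b p \<Psi> \<Psi>' = \<epsilon> * (J + k \<epsilon> \<bullet> K)"
      proof -
        have "((\<lambda>t. \<epsilon> * (p t \<bullet> \<psi>' t) + \<kappa> \<bullet> (z' t *\<^sub>R snd (p t))) has_integral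
            \<epsilon> * integral {a..b} (\<lambda>t. p t \<bullet> \<psi>' t) + \<kappa> \<bullet> integral {a..b} (\<lambda>t. z' t *\<^sub>R snd (p t))) {a..b}"
          by (intro has_integral_add has_integral_mult_right has_integral_linear[OF _ bounded_linear_inner_right, unfolded o_def]
              integrable_integral integrable_continuous_real continuous_intros p \<psi> z)
        also have "(\<lambda>t. \<epsilon> * (p t \<bullet> \<psi>' t) + \<kappa> \<bullet> (z' t *\<^sub>R snd (p t))) = (\<lambda>t. p t \<bullet> \<Psi>' t)"
          by (simp add: fun_eq_iff \<Psi>'_def inner_prod_def algebra_simps inner_commute)
        finally have "integral {a..b} (\<lambda>t. p t \<bullet> \<Psi>' t) =
            \<epsilon> * integral {a..b} (\<lambda>t. p t \<bullet> \<psi>' t) + \<kappa> \<bullet> integral {a..b} (\<lambda>t. z' t *\<^sub>R snd (p t))"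
          by (rule integral_unique)
        then show ?thesis
          by (simp add: weak_pairing_def J_def K_def \<Psi>_def \<kappa>_def inner_prod_def algebra_simps inner_commute)
      qed
      moreover have "integral {a..b} (\<lambda>t. \<Psi> t \<bullet> \<Psi> t) = \<epsilon>\<^sup>2 * (A + 2 * (k \<epsilon> \<bullet> B) + (k \<epsilon> \<bullet> k \<epsilon>) * Z)"
      proof -
        have "((\<lambda>t. \<epsilon>\<^sup>2 * (\<psi> t \<bullet> \<psi> t) + (2 * \<epsilon>) * (\<kappa> \<bullet> (z t *\<^sub>R snd (\<psi> t))) + (\<kappa> \<bullet> \<kappa>) * (z t * z t)) has_integral
            \<epsilon>\<^sup>2 * A + (2 * \<epsilon>) * (\<kappa> \<bullet> B) + (\<kappa> \<bullet> \<kappa>) * Z) {a..b}"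
          unfolding A_def B_def Z_def
          by (intro has_integral_add has_integral_mult_right has_integral_linear[OF _ bounded_linear_inner_right, unfolded o_def]
              integrable_integral integrable_continuous_real continuous_intros p \<psi> z)
        also have "(\<lambda>t. \<epsilon>\<^sup>2 * (\<psi> t \<bullet> \<psi> t) + (2 * \<epsilon>) * (\<kappa> \<bullet> (z t *\<^sub>R snd (\<psi> t))) + (\<kappa> \<bullet> \<kappa>) * (z t * z t)) = (\<lambda>t. \<Psi> t \<bullet> \<Psi> t)"
          by (simp add: fun_eq_iff \<Psi>_def inner_prod_def algebra_simps inner_commute power2_eq_square)
        finally show ?thesis
          by (simp add: integral_unique \<kappa>_def algebra_simps power2_eq_square)
      qed
      ultimately have "0 \<le> \<epsilon> * h \<epsilon>"
        by (simp add: h_def algebra_simps power2_eq_square)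
      with \<open>\<epsilon> > 0\<close> show ?thesis by (simp add: zero_le_mult_iff)
    qed
    have den: "((\<lambda>\<epsilon>. m + \<epsilon> * n) \<longlongrightarrow> m + 0 * n) (at_right 0)"
      by (intro tendsto_intros)
    then have "\<forall>\<^sub>F \<epsilon> in at_right 0. m + \<epsilon> * n \<noteq> 0"
      using m0 by (intro tendsto_imp_eventually_ne[OF den]) (simp add: m_def)
    then have ev: "\<forall>\<^sub>F \<epsilon> in at_right 0. 0 \<le> h \<epsilon>"
      using eventually_at_right_less[of 0] by eventually_elim (rule pos)
    have k: "(k \<longlongrightarrow> (- 1 / m) *\<^sub>R D) (at_right 0)"
    proof -
      have "(k \<longlongrightarrow> (- 1 / (m + 0 * n)) *\<^sub>R (D + (0 / 2) *\<^sub>R S)) (at_right 0)"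
        unfolding k_def[abs_def] using m0 by (intro tendsto_intros) (auto simp: m_def)
      then show ?thesis by simp
    qed
    \<comment> \<open>The change of energy is \<open>\<epsilon> h \<epsilon>\<close>; the limit of \<open>h\<close> at 0 is its first-order part.\<close>
    have "(h \<longlongrightarrow> 2 * (J + ((- 1 / m) *\<^sub>R D) \<bullet> K) + 0 * (A + 2 * (((- 1 / m) *\<^sub>R D) \<bullet> B) + (((- 1 / m) *\<^sub>R D) \<bullet> ((- 1 / m) *\<^sub>R D)) * Z)) (at_right 0)"
      unfolding h_def[abs_def] by (intro tendsto_intros k)
    from tendsto_lowerbound[OF this ev] have "0 \<le> J + ((- 1 / m) *\<^sub>R D) \<bullet> K"
      by simp
    then show ?thesis
      by (simp add: J_def D_def \<mu>_def inner_commute)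
  qed
  show ?thesis
  proof (intro exI allI impI)
    fix \<psi> \<psi>' :: "real \<Rightarrow> real \<times> (real^3)"
    assume \<psi>: "test_function a b \<psi> \<psi>'"
    \<comment> \<open>The left side is linear in \<open>\<psi>\<close>, so the inequality for \<open>\<psi>\<close> and \<open>- \<psi>\<close> is an equality.\<close>
    have neg: "test_function a b (\<lambda>t. - \<psi> t) (\<lambda>t. - \<psi>' t)"
      using \<psi> by (auto simp: test_function_def intro!: has_vector_derivative_minus continuous_intros)
    have "weak_pairing a b p (\<lambda>t. - \<psi> t) (\<lambda>t. - \<psi>' t) = - weak_pairing a b p \<psi> \<psi>'"
      by (simp add: weak_pairing_def)
    then show "weak_pairing a b p \<psi> \<psi>' + \<mu> \<bullet> integral {a..b} (\<lambda>t. area_form (p t) (\<psi> t)) = 0"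
      using ineq[OF \<psi>] ineq[OF neg] by (simp add: area.minus_right)
  qed
qed

lemma minimal_imp_ode:
  assumes "a < b" and p: "continuous_on {a..b} p" and min: "area_constrained_minimal a b p"
  shows "\<exists>\<mu> c. \<forall>t\<in>{a..b}. (p has_vector_derivative c + rot \<mu> (p t)) (at t within {a..b})"
proof (cases "\<exists>c. \<forall>t\<in>{a..b}. fst (p t) = c")
  case True
  then obtain x0 where "\<And>t. t \<in> {a..b} \<Longrightarrow> fst (p t) = x0" by blast
  from minimal_constant_fst_imp_ode[OF assms this] obtain c
    where "\<forall>t\<in>{a..b}. (p has_vector_derivative c + rot 0 (p t)) (at t within {a..b})"
    by (auto simp: rot_def simp flip: zero_prod_def)
  then show ?thesis by blast
next
  case False
  then show ?thesis
    using minimal_imp_multiplier[OF assms] multiplier_equation_imp_ode[OF \<open>a < b\<close> p] by blast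
qed

section \<open>The geodesic equation and gluing of arcs\<close>

text \<open>
  The geodesic equation for the planar path, integrated once. The component of the velocity in the
  plane of the \<open>x\<close>-axis and \<open>\<mu>\<close> turns with constant angular velocity \<open>\<bar>\<mu>\<bar>\<close>, the orthogonal
  component is constant.
\<close>

definition rot_ode ::
    "real^3 \<Rightarrow> real \<times> (real^3) \<Rightarrow> real \<Rightarrow> real \<Rightarrow> (real \<Rightarrow> real \<times> (real^3)) \<Rightarrow> bool" where
  "rot_ode \<mu> c a b p \<longleftrightarrow> (\<forall>t\<in>{a..b}. (p has_vector_derivative c + rot \<mu> (p t)) (at t within {a..b}))"

lemma rot_odeD:
  "rot_ode \<mu> c a b p \<Longrightarrow> t \<in> {a..b} \<Longrightarrow> (p has_vector_derivative c + rot \<mu> (p t)) (at t within {a..b})"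
  by (simp add: rot_ode_def)

lemma rot_ode_subinterval:
  assumes "rot_ode \<mu> c a b p" "a \<le> a'" "b' \<le> b"
  shows "rot_ode \<mu> c a' b' p"
  unfolding rot_ode_def using assms
  by (auto intro!: has_vector_derivative_within_subset[OF rot_odeD[OF assms(1)]])

text \<open>
  Skew-symmetry of \<open>rot \<mu>\<close> makes \<open>\<bar>v\<bar>\<close> constant.
\<close>

lemma rot_ode_homogeneous_zero:
  assumes v: "rot_ode \<mu> 0 a b v" and t0: "t0 \<in> {a..b}" "v t0 = 0" and t: "t \<in> {a..b}"
  shows "v t = 0"
proof -
  have "((\<lambda>t. v t \<bullet> v t) has_vector_derivative 0) (at t within {a..b})" if "t \<in> {a..b}" for t
  proof -
    have "((\<lambda>t. v t \<bullet> v t) has_vector_derivative v t \<bullet> rot \<mu> (v t) + rot \<mu> (v t) \<bullet> v t) (at t within {a..b})"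
      using rot_odeD[OF v that] by (intro bounded_bilinear.has_vector_derivative[OF bounded_bilinear_inner]) auto
    moreover have "v t \<bullet> rot \<mu> (v t) + rot \<mu> (v t) \<bullet> v t = 0"
      by (simp add: rot_def inner_prod_def inner_commute)
    ultimately show ?thesis by simp
  qed
  then obtain r where "\<And>t. t \<in> {a..b} \<Longrightarrow> v t \<bullet> v t = r"
    using has_vector_derivative_zero_constant[of "{a..b}" "\<lambda>t. v t \<bullet> v t"] by auto
  then show ?thesis using t0 t by (metis inner_eq_zero_iff inner_zero_left)
qed

lemma rot_ode_unique:
  assumes p: "rot_ode \<mu> c a b p" and q: "rot_ode \<mu> c a b q"
    and t0: "t0 \<in> {a..b}" "p t0 = q t0" and t: "t \<in> {a..b}"
  shows "p t = q t"
proof -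
  interpret rot: bounded_linear "rot \<mu>" by (rule bounded_linear_rot)
  have "rot_ode \<mu> 0 a b (\<lambda>t. p t - q t)"
    unfolding rot_ode_def
  proof
    fix t assume "t \<in> {a..b}"
    from has_vector_derivative_diff[OF rot_odeD[OF p this] rot_odeD[OF q this]]
    show "((\<lambda>t. p t - q t) has_vector_derivative 0 + rot \<mu> (p t - q t)) (at t within {a..b})"
      by (simp add: rot.diff)
  qed
  from rot_ode_homogeneous_zero[OF this t0(1) _ t] t0(2) show ?thesis by simp
qed

text \<open>
  Since the acceleration \<open>rot \<mu> (c + rot \<mu> p)\<close> vanishes at \<open>t0\<close>, the difference between the velocity
  and its value at \<open>t0\<close> solves the homogeneous equation, hence is zero throughout.
\<close>

lemma rot_ode_straight:
  assumes p: "rot_ode \<mu> c a b p" and t0: "t0 \<in> {a..b}" and stat: "rot \<mu> (c + rot \<mu> (p t0)) = 0"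
  shows "rot_ode 0 (c + rot \<mu> (p t0)) a b p"
proof -
  interpret rot: bounded_linear "rot \<mu>" by (rule bounded_linear_rot)
  define w where "w = c + rot \<mu> (p t0)"
  have "rot_ode \<mu> 0 a b (\<lambda>t. c + rot \<mu> (p t) - w)"
    unfolding rot_ode_def
  proof
    fix t assume "t \<in> {a..b}"
    then have "((\<lambda>t. c + rot \<mu> (p t) - w) has_vector_derivative 0 + rot \<mu> (c + rot \<mu> (p t)) - 0) (at t within {a..b})"
      by (intro derivative_intros rot.has_vector_derivative rot_odeD[OF p])
    moreover have "rot \<mu> (c + rot \<mu> (p t) - w) = rot \<mu> (c + rot \<mu> (p t))"
      using rot.diff[of "c + rot \<mu> (p t)" w] stat[folded w_def] by simp
    ultimately show "((\<lambda>t. c + rot \<mu> (p t) - w) has_vector_derivative 0 + rot \<mu> (c + rot \<mu> (p t) - w)) (at t within {a..b})"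
      by simp
  qed
  from rot_ode_homogeneous_zero[OF this t0] have "c + rot \<mu> (p t) = w" if "t \<in> {a..b}" for t
    using that by (simp add: w_def)
  then show ?thesis
    using rot_odeD[OF p] unfolding rot_ode_def w_def[symmetric]
    by (simp add: rot_def[of 0] flip: zero_prod_def)
qed

lemma rot_ode_append:
  assumes 1: "rot_ode \<mu> c a b p" and 2: "rot_ode \<mu> c a' b' p" and le: "a \<le> a'" "a' < b" "b \<le> b'"
  shows "rot_ode \<mu> c a b' p"
  unfolding rot_ode_def
proof
  fix t assume t: "t \<in> {a..b'}"
  show "(p has_vector_derivative c + rot \<mu> (p t)) (at t within {a..b'})"
  proof (cases "t < b")
    case True
    then have "at t within {a..b'} = at t within {a..b}"
      using le by (intro at_within_nhd[of t "{..<b}"]) auto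
    then show ?thesis using rot_odeD[OF 1] t True by simp
  next
    case False
    then have "at t within {a..b'} = at t within {a'..b'}"
      using le by (intro at_within_nhd[of t "{a'<..}"]) auto
    then show ?thesis using rot_odeD[OF 2] t False le by simp
  qed
qed

text \<open>
  The multiplier of an arc need not be unique, but it fails to be so only on straight lines. If
  \<open>\<mu> \<noteq> \<mu>'\<close>, differentiating the equality of the two expressions for the velocity \<open>u\<close> on the
  overlap gives \<open>rot (\<mu> - \<mu>') u = 0\<close>, which forces the \<open>x\<close>-component of \<open>u\<close> to vanish there. Then
  the acceleration vanishes too, and both arcs have the same constant velocity, which is the
  equation with multiplier 0.
\<close>

lemma rot_ode_glue:
  assumes 1: "rot_ode \<mu> c a b p" and 2: "rot_ode \<mu>' c' a' b' p" and le: "a \<le> a'" "a' < b" "b \<le> b'"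
  shows "\<exists>\<mu> c. rot_ode \<mu> c a b' p"
proof -
  define u where "u t = c + rot \<mu> (p t)" for t
  have o1: "rot_ode \<mu> c a' b p" and o2: "rot_ode \<mu>' c' a' b p"
    using rot_ode_subinterval[OF 1] rot_ode_subinterval[OF 2] le by auto
  have uniq: "v = w" if "(f has_vector_derivative v) (at t within {a'..b})" "(f has_vector_derivative w) (at t within {a'..b})"
    "t \<in> {a'..b}" for f :: "real \<Rightarrow> real \<times> (real^3)" and v w t
    using that vector_derivative_within_closed_interval[OF \<open>a' < b\<close> that(3)] by metis
  have u': "u t = c' + rot \<mu>' (p t)" if "t \<in> {a'..b}" for t
    unfolding u_def by (rule uniq[OF rot_odeD[OF o1 that] rot_odeD[OF o2 that] that])
  have ab: "a' \<in> {a'..b}" using le by auto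
  show ?thesis
  proof (cases "\<mu> = \<mu>'")
    case True
    with u'[OF ab] have "c' = c" by (simp add: u_def)
    with True 1 2 le show ?thesis by (blast intro: rot_ode_append)
  next
    case False
    define \<nu> where "\<nu> = \<mu> - \<mu>'"
    interpret r: bounded_linear "rot \<mu>" by (rule bounded_linear_rot)
    interpret n: bounded_linear "rot \<nu>" by (rule bounded_linear_rot)
    have zero: "fst (u t) = 0" if t: "t \<in> {a'..b}" for t
    proof -
      have "((\<lambda>t. rot \<nu> (p t)) has_vector_derivative rot \<nu> (u t)) (at t within {a'..b})"
        unfolding u_def by (intro n.has_vector_derivative rot_odeD[OF o1 t])
      moreover have "((\<lambda>t. rot \<nu> (p t)) has_vector_derivative 0) (at t within {a'..b})"
      proof (rule has_vector_derivative_transform[OF t])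
        show "rot \<nu> (p s) = c' - c" if "s \<in> {a'..b}" for s
          using u'[OF that] by (simp add: u_def \<nu>_def rot_def prod_eq_iff algebra_simps)
      qed simp
      ultimately have "rot \<nu> (u t) = 0" using uniq t by blast
      then show ?thesis using False by (auto simp: rot_def \<nu>_def zero_prod_def)
    qed
    have stat: "rot m (u a') = 0"
      if o: "rot_ode m k a' b p" and u: "\<And>t. t \<in> {a'..b} \<Longrightarrow> u t = k + rot m (p t)" for m k
    proof -
      have "((\<lambda>t. k + rot m (p t)) has_vector_derivative 0 + rot m (u a')) (at a' within {a'..b})"
        unfolding u[OF ab]
        by (intro derivative_intros bounded_linear.has_vector_derivative[OF bounded_linear_rot] rot_odeD[OF o ab])
      then have "((\<lambda>t. (fst (k + rot m (p t)), 0::real^3)) has_vector_derivative (fst (rot m (u a')), 0)) (at a' within {a'..b})"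
        by (intro has_vector_derivative_Pair has_vector_derivative_const
            bounded_linear.has_vector_derivative[OF bounded_linear_fst]) simp
      moreover have "((\<lambda>t. (fst (k + rot m (p t)), 0::real^3)) has_vector_derivative 0) (at a' within {a'..b})"
      proof (rule has_vector_derivative_transform[OF ab])
        show "(fst (k + rot m (p s)), 0::real^3) = 0" if "s \<in> {a'..b}" for s
          using zero[OF that] u[OF that] by (simp add: zero_prod_def)
      qed simp
      ultimately have "fst (rot m (u a')) = 0"
        using uniq[OF _ _ ab] by (metis fst_conv fst_zero)
      then show ?thesis
        using zero[OF ab] by (simp add: rot_def prod_eq_iff)
    qed
    have s1: "rot \<mu> (c + rot \<mu> (p a')) = 0"
      using stat[OF o1] by (simp add: u_def)
    have s2: "rot \<mu>' (c' + rot \<mu>' (p a')) = 0"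
      using stat[OF o2 u'] u'[OF ab] by simp
    have "rot_ode 0 (u a') a b p" "rot_ode 0 (u a') a' b' p"
      using rot_ode_straight[OF 1 _ s1] rot_ode_straight[OF 2 _ s2] le u'[OF ab] by (auto simp: u_def)
    then show ?thesis using le by (blast intro: rot_ode_append)
  qed
qed

section \<open>Explicit extremals and the vanishing of the determinant\<close>

text \<open>
  With \<open>S = 2 * \<sigma>\<close> this is positivity of \<open>g S = S\<^sup>2 + S sin S - 4 + 4 cos S\<close>, which vanishes at 0 and has
  derivative \<open>2 S + S cos S - 3 sin S\<close>. Positivity of the latter is the classical bound
  \<open>sin S / S < (2 + cos S) / 3\<close>, obtained up to \<open>\<pi>\<close> by repeated differentiation, and beyond \<open>\<pi>\<close> from
  \<open>S > 3\<close>.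
\<close>

lemma two_sin_squared_less:
  fixes \<sigma> :: real
  assumes "\<sigma> > 0"
  shows "2 * (sin \<sigma>)\<^sup>2 < \<sigma>\<^sup>2 + \<sigma> * sin \<sigma> * cos \<sigma>"
proof -
  have 1: "0 < sin S - S * cos S" if "0 < S" "S \<le> pi" for S :: real
  proof -
    have "(\<lambda>S. sin S - S * cos S) 0 < (\<lambda>S. sin S - S * cos S) S"
    proof (rule DERIV_pos_imp_increasing_open[OF \<open>0 < S\<close>])
      fix x assume x: "0 < x" "x < S"
      have "((\<lambda>S. sin S - S * cos S) has_real_derivative x * sin x) (at x)"
        by (auto intro!: derivative_eq_intros)
      moreover have "0 < x * sin x" using x that sin_gt_zero[of x] by simp
      ultimately show "\<exists>y. ((\<lambda>S. sin S - S * cos S) has_real_derivative y) (at x) \<and> 0 < y" by blast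
    qed (intro continuous_intros)
    then show ?thesis by simp
  qed
  have 2: "0 < 2 - 2 * cos S - S * sin S" if "0 < S" "S \<le> pi" for S :: real
  proof -
    have "(\<lambda>S. 2 - 2 * cos S - S * sin S) 0 < (\<lambda>S. 2 - 2 * cos S - S * sin S) S"
    proof (rule DERIV_pos_imp_increasing_open[OF \<open>0 < S\<close>])
      fix x assume x: "0 < x" "x < S"
      have "((\<lambda>S. 2 - 2 * cos S - S * sin S) has_real_derivative sin x - x * cos x) (at x)"
        by (auto intro!: derivative_eq_intros)
      moreover have "0 < sin x - x * cos x" using x that 1[of x] by simp
      ultimately show "\<exists>y. ((\<lambda>S. 2 - 2 * cos S - S * sin S) has_real_derivative y) (at x) \<and> 0 < y" by blast
    qed (intro continuous_intros)
    then show ?thesis by simp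
  qed
  have 3: "0 < 2 * S + S * cos S - 3 * sin S" if "0 < S" for S :: real
  proof (cases "S \<le> pi")
    case True
    have "(\<lambda>S. 2 * S + S * cos S - 3 * sin S) 0 < (\<lambda>S. 2 * S + S * cos S - 3 * sin S) S"
    proof (rule DERIV_pos_imp_increasing_open[OF \<open>0 < S\<close>])
      fix x assume x: "0 < x" "x < S"
      have "((\<lambda>S. 2 * S + S * cos S - 3 * sin S) has_real_derivative 2 - 2 * cos x - x * sin x) (at x)"
        by (auto intro!: derivative_eq_intros)
      moreover have "0 < 2 - 2 * cos x - x * sin x" using x True 2[of x] by simp
      ultimately show "\<exists>y. ((\<lambda>S. 2 * S + S * cos S - 3 * sin S) has_real_derivative y) (at x) \<and> 0 < y" by blast
    qed (intro continuous_intros)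
    then show ?thesis by simp
  next
    case False
    have "3 < S" using False pi_gt3 by linarith
    moreover have "S * (- 1) \<le> S * cos S" using \<open>0 < S\<close> by (intro mult_left_mono) auto
    moreover have "sin S \<le> 1" by simp
    ultimately show ?thesis by linarith
  qed
  define g where "g S = S\<^sup>2 + S * sin S - 4 + 4 * cos S" for S :: real
  have "g 0 < g (2 * \<sigma>)"
  proof (rule DERIV_pos_imp_increasing_open[of 0 "2 * \<sigma>" g])
    fix x :: real assume x: "0 < x" "x < 2 * \<sigma>"
    have "(g has_real_derivative 2 * x + x * cos x - 3 * sin x) (at x)"
      unfolding g_def by (auto intro!: derivative_eq_intros)
    with 3[OF x(1)] show "\<exists>y. (g has_real_derivative y) (at x) \<and> 0 < y" by blast
  next
    show "continuous_on {0..2 * \<sigma>} g" unfolding g_def by (intro continuous_intros)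
  qed (use assms in auto)
  then show ?thesis
    by (simp add: g_def sin_double cos_double_sin power_mult_distrib)
qed

text \<open>
  Let \<open>\<theta> = \<bar>\<mu>\<bar>\<close>, \<open>e = \<mu> / \<theta>\<close>, and let the initial velocity be \<open>(r, \<alpha> e + w)\<close> with \<open>w\<close> orthogonal to
  \<open>e\<close>. The solution from the origin is \<open>x = helix_x\<close>, \<open>\<ell> = helix_axial e + t w\<close>, with vertical part
  \<open>y = area_axial e + area_drift w\<close>: a circle in the plane of the \<open>x\<close>-axis and \<open>e\<close>, drifting with
  velocity \<open>w\<close>.
\<close>

definition helix_x :: "real \<Rightarrow> real \<Rightarrow> real \<Rightarrow> real \<Rightarrow> real" where
  "helix_x \<theta> r \<alpha> t = (r * sin (\<theta> * t) + \<alpha> * (1 - cos (\<theta> * t))) / \<theta>"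

definition helix_axial :: "real \<Rightarrow> real \<Rightarrow> real \<Rightarrow> real \<Rightarrow> real" where
  "helix_axial \<theta> r \<alpha> t = (\<alpha> * sin (\<theta> * t) - r * (1 - cos (\<theta> * t))) / \<theta>"

definition area_axial :: "real \<Rightarrow> real \<Rightarrow> real \<Rightarrow> real \<Rightarrow> real" where
  "area_axial \<theta> r \<alpha> t = - (r\<^sup>2 + \<alpha>\<^sup>2) * (\<theta> * t - sin (\<theta> * t)) / (2 * \<theta>\<^sup>2)"

definition area_drift :: "real \<Rightarrow> real \<Rightarrow> real \<Rightarrow> real \<Rightarrow> real" where
  "area_drift \<theta> r \<alpha> t =
     (r * (1 - cos (\<theta> * t)) + \<alpha> * (\<theta> * t - sin (\<theta> * t))) / \<theta>\<^sup>2 - t * helix_x \<theta> r \<alpha> t / 2"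

text \<open>
  This is the determinant of \<open>\<ell>\<close> and \<open>y\<close> with respect to \<open>e\<close> and \<open>w\<close>. In the half angle \<open>\<sigma> = \<theta> t / 2\<close>,
  with \<open>s = sin \<sigma>\<close> and \<open>k = cos \<sigma>\<close>, it equals
  \<open>2 (\<sigma> (\<sigma> - s k) (r\<^sup>2 + \<alpha>\<^sup>2) - 2 s (s - \<sigma> k) M\<^sup>2) / \<theta>\<^sup>3\<close>, where \<open>M\<close> is the component of \<open>(r, \<alpha>)\<close>
  in a unit direction. Thus \<open>M\<^sup>2 \<le> r\<^sup>2 + \<alpha>\<^sup>2\<close>, and the trigonometric inequality decides the worst case.
\<close>

lemma helix_determinant_pos:
  assumes "\<theta> > 0" "t > 0" and nz: "(r, \<alpha>) \<noteq> (0, 0)"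
  shows "0 < helix_axial \<theta> r \<alpha> t * area_drift \<theta> r \<alpha> t - t * area_axial \<theta> r \<alpha> t"
proof -
  define \<sigma> where "\<sigma> = \<theta> * t / 2"
  define s where "s = sin \<sigma>"
  define k where "k = cos \<sigma>"
  define M where "M = \<alpha> * k - r * s"
  have \<sigma>: "\<sigma> > 0" "\<theta> * t = 2 * \<sigma>" using assms by (simp_all add: \<sigma>_def)
  have t: "t = 2 * \<sigma> / \<theta>" using assms by (simp add: \<sigma>_def)
  have sk: "s\<^sup>2 + k\<^sup>2 = 1" by (simp add: s_def k_def)
  have S: "sin (\<theta> * t) = 2 * s * k" "1 - cos (\<theta> * t) = 2 * s\<^sup>2"
    by (simp_all add: \<sigma>(2) s_def k_def sin_double cos_double_sin)
  have x: "helix_x \<theta> r \<alpha> t = (2 * r * s * k + 2 * \<alpha> * s\<^sup>2) / \<theta>"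
    by (simp add: helix_x_def S)
  have a: "helix_axial \<theta> r \<alpha> t = 2 * s * M / \<theta>"
    by (simp add: helix_axial_def S M_def algebra_simps power2_eq_square)
  have ya: "area_axial \<theta> r \<alpha> t = - (r\<^sup>2 + \<alpha>\<^sup>2) * (\<sigma> - s * k) / \<theta>\<^sup>2"
    unfolding area_axial_def S(1) unfolding \<sigma>(2) using assms(1) by (simp add: field_simps)
  have yw: "area_drift \<theta> r \<alpha> t = - 2 * (s - \<sigma> * k) * M / \<theta>\<^sup>2"
  proof -
    have "\<alpha> * \<sigma> = \<alpha> * \<sigma> * (s\<^sup>2 + k\<^sup>2)" by (simp add: sk)
    then have *: "2 * r * s\<^sup>2 + \<alpha> * (2 * \<sigma> - 2 * s * k) - \<sigma> * (2 * r * s * k + 2 * \<alpha> * s\<^sup>2) = - 2 * (s - \<sigma> * k) * M"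
      unfolding M_def by (simp add: algebra_simps power2_eq_square)
    have "area_drift \<theta> r \<alpha> t = (2 * r * s\<^sup>2 + \<alpha> * (2 * \<sigma> - 2 * s * k)) / \<theta>\<^sup>2 - \<sigma> * (2 * r * s * k + 2 * \<alpha> * s\<^sup>2) / \<theta>\<^sup>2"
      unfolding area_drift_def x S unfolding \<sigma>(2) by (simp add: t power2_eq_square)
    also have "\<dots> = - 2 * (s - \<sigma> * k) * M / \<theta>\<^sup>2"
      unfolding *[symmetric] by (simp add: diff_divide_distrib)
    finally show ?thesis .
  qed
  have R: "0 < r\<^sup>2 + \<alpha>\<^sup>2" using nz by (auto simp: sum_power2_gt_zero_iff)
  have M: "M\<^sup>2 \<le> r\<^sup>2 + \<alpha>\<^sup>2"
  proof -
    have "M\<^sup>2 + (\<alpha> * s + r * k)\<^sup>2 = (r\<^sup>2 + \<alpha>\<^sup>2) * (s\<^sup>2 + k\<^sup>2)"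
      by (simp add: M_def power2_eq_square algebra_simps)
    then have "M\<^sup>2 + (\<alpha> * s + r * k)\<^sup>2 = r\<^sup>2 + \<alpha>\<^sup>2" by (simp add: sk)
    then show ?thesis using zero_le_power2[of "\<alpha> * s + r * k"] by linarith
  qed
  have lin: "0 < \<sigma> - s * k"
  proof (rule ccontr)
    \<comment> \<open>Otherwise \<open>\<sigma>\<^sup>2\<close> and \<open>\<sigma> s k\<close> would both be at most \<open>s\<^sup>2\<close>, against the same inequality.\<close>
    assume "\<not> 0 < \<sigma> - s * k"
    then have le: "\<sigma> \<le> s * k" by simp
    then have "\<sigma> * \<sigma> \<le> \<sigma> * (s * k)" "\<sigma> * (s * k) \<le> (s * k) * (s * k)"
      using \<sigma>(1) by (auto intro: mult_left_mono mult_right_mono)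
    moreover have "(s * k) * (s * k) \<le> s\<^sup>2"
    proof -
      have "(s * k) * (s * k) = s\<^sup>2 * k\<^sup>2" by (simp add: power2_eq_square)
      also have "\<dots> \<le> s\<^sup>2 * 1"
        using sk zero_le_power2[of s] by (intro mult_left_mono) linarith+
      finally show ?thesis by simp
    qed
    moreover have "2 * s\<^sup>2 < \<sigma> * \<sigma> + \<sigma> * (s * k)"
      using two_sin_squared_less[OF \<sigma>(1)] by (simp add: s_def k_def power2_eq_square mult.assoc)
    ultimately show False by linarith
  qed
  have "2 * (s * (s - \<sigma> * k)) * M\<^sup>2 < \<sigma> * (\<sigma> - s * k) * (r\<^sup>2 + \<alpha>\<^sup>2)"
  proof (cases "s * (s - \<sigma> * k) \<le> 0")
    case True
    then have "2 * (s * (s - \<sigma> * k)) * M\<^sup>2 \<le> 0"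
      using mult_nonpos_nonneg[OF True zero_le_power2[of M]] by linarith
    also have "0 < \<sigma> * (\<sigma> - s * k) * (r\<^sup>2 + \<alpha>\<^sup>2)" using \<sigma>(1) lin R by simp
    finally show ?thesis .
  next
    case False
    then have "2 * (s * (s - \<sigma> * k)) * M\<^sup>2 \<le> 2 * (s * (s - \<sigma> * k)) * (r\<^sup>2 + \<alpha>\<^sup>2)"
      using M by (intro mult_left_mono) auto
    also have "\<dots> < \<sigma> * (\<sigma> - s * k) * (r\<^sup>2 + \<alpha>\<^sup>2)"
    proof (rule mult_strict_right_mono[OF _ R])
      show "2 * (s * (s - \<sigma> * k)) < \<sigma> * (\<sigma> - s * k)"
        using two_sin_squared_less[OF \<sigma>(1)]
        by (simp add: s_def k_def algebra_simps power2_eq_square)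
    qed
    finally show ?thesis .
  qed
  then have "0 < 2 * (\<sigma> * (\<sigma> - s * k) * (r\<^sup>2 + \<alpha>\<^sup>2) - 2 * (s * (s - \<sigma> * k)) * M\<^sup>2) / \<theta> ^ 3"
    using \<open>\<theta> > 0\<close> by simp
  also have "\<dots> = helix_axial \<theta> r \<alpha> t * area_drift \<theta> r \<alpha> t - t * area_axial \<theta> r \<alpha> t"
    unfolding a ya yw using \<open>\<theta> > 0\<close>
    by (subst t) (simp add: field_simps power2_eq_square power3_eq_cube)
  finally show ?thesis .
qed

lemma helix_derivatives:
  assumes "\<theta> \<noteq> 0"
  shows helix_x_derivative: "(helix_x \<theta> r \<alpha> has_real_derivative r + \<theta> * helix_axial \<theta> r \<alpha> t) (at t within S)"
    and helix_axial_derivative: "(helix_axial \<theta> r \<alpha> has_real_derivative \<alpha> - \<theta> * helix_x \<theta> r \<alpha> t) (at t within S)"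
    and area_axial_derivative: "(area_axial \<theta> r \<alpha> has_real_derivative
      (helix_x \<theta> r \<alpha> t * (\<alpha> - \<theta> * helix_x \<theta> r \<alpha> t) - (r + \<theta> * helix_axial \<theta> r \<alpha> t) * helix_axial \<theta> r \<alpha> t) / 2) (at t within S)"
    and area_drift_derivative: "(area_drift \<theta> r \<alpha> has_real_derivative
      (helix_x \<theta> r \<alpha> t - (r + \<theta> * helix_axial \<theta> r \<alpha> t) * t) / 2) (at t within S)"
proof -
  show x: "(helix_x \<theta> r \<alpha> has_real_derivative r + \<theta> * helix_axial \<theta> r \<alpha> t) (at t within S)"
    unfolding helix_x_def[abs_def] helix_axial_def using assms
    by (auto intro!: derivative_eq_intros simp: field_simps)
  show "(helix_axial \<theta> r \<alpha> has_real_derivative \<alpha> - \<theta> * helix_x \<theta> r \<alpha> t) (at t within S)"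
    unfolding helix_x_def helix_axial_def[abs_def] using assms
    by (auto intro!: derivative_eq_intros simp: field_simps)
  have "(area_axial \<theta> r \<alpha> has_real_derivative - (r\<^sup>2 + \<alpha>\<^sup>2) * (1 - cos (\<theta> * t)) / (2 * \<theta>)) (at t within S)"
    unfolding area_axial_def[abs_def] using assms
    by (auto intro!: derivative_eq_intros simp: field_simps power2_eq_square)
  moreover have "- (r\<^sup>2 + \<alpha>\<^sup>2) * (1 - cos (\<theta> * t)) / (2 * \<theta>) =
      (helix_x \<theta> r \<alpha> t * (\<alpha> - \<theta> * helix_x \<theta> r \<alpha> t) - (r + \<theta> * helix_axial \<theta> r \<alpha> t) * helix_axial \<theta> r \<alpha> t) / 2"
  proof -
    define s where "s = sin (\<theta> * t)"
    define k where "k = cos (\<theta> * t)"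
    have sk: "s * s = 1 - k * k" using sin_cos_squared_add[of "\<theta> * t"] by (simp add: s_def k_def power2_eq_square)
    have "(r * s + \<alpha> * (1 - k)) * (\<alpha> * k - r * s) - (r * k + \<alpha> * s) * (\<alpha> * s - r * (1 - k)) = (r\<^sup>2 + \<alpha>\<^sup>2) * (k - k * k - s * s)"
      by (simp add: algebra_simps power2_eq_square)
    also have "\<dots> = - (r\<^sup>2 + \<alpha>\<^sup>2) * (1 - k)"
      unfolding sk by (simp add: algebra_simps)
    finally have *: "(r * s + \<alpha> * (1 - k)) * (\<alpha> * k - r * s) - (r * k + \<alpha> * s) * (\<alpha> * s - r * (1 - k)) = - (r\<^sup>2 + \<alpha>\<^sup>2) * (1 - k)" .
    have X: "helix_x \<theta> r \<alpha> t = (r * s + \<alpha> * (1 - k)) / \<theta>" "helix_axial \<theta> r \<alpha> t = (\<alpha> * s - r * (1 - k)) / \<theta>"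
      by (simp_all add: helix_x_def helix_axial_def s_def k_def)
    have d: "\<alpha> - \<theta> * helix_x \<theta> r \<alpha> t = \<alpha> * k - r * s" "r + \<theta> * helix_axial \<theta> r \<alpha> t = r * k + \<alpha> * s"
      unfolding X using assms by (simp_all add: field_simps)
    have "(A * B - C * D) / (2 * \<theta>) = (A / \<theta> * B - C * (D / \<theta>)) / 2" for A B C D :: real
      using assms by (simp add: field_simps)
    then show ?thesis
      unfolding d unfolding X k_def[symmetric] *[symmetric] .
  qed
  ultimately show "(area_axial \<theta> r \<alpha> has_real_derivative
      (helix_x \<theta> r \<alpha> t * (\<alpha> - \<theta> * helix_x \<theta> r \<alpha> t) - (r + \<theta> * helix_axial \<theta> r \<alpha> t) * helix_axial \<theta> r \<alpha> t) / 2) (at t within S)"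
    by (simp only:)
  have "((\<lambda>t. (r * (1 - cos (\<theta> * t)) + \<alpha> * (\<theta> * t - sin (\<theta> * t))) / \<theta>\<^sup>2) has_real_derivative helix_x \<theta> r \<alpha> t) (at t within S)"
    unfolding helix_x_def using assms
    by (auto intro!: derivative_eq_intros simp: field_simps power2_eq_square)
  then have "(area_drift \<theta> r \<alpha> has_real_derivative
      helix_x \<theta> r \<alpha> t - (1 * helix_x \<theta> r \<alpha> t + (r + \<theta> * helix_axial \<theta> r \<alpha> t) * t) / 2) (at t within S)"
    unfolding area_drift_def[abs_def]
    by (intro DERIV_diff DERIV_cdivide DERIV_mult DERIV_ident x)
  then show "(area_drift \<theta> r \<alpha> has_real_derivative
      (helix_x \<theta> r \<alpha> t - (r + \<theta> * helix_axial \<theta> r \<alpha> t) * t) / 2) (at t within S)"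
    by (simp add: field_simps)
qed

definition lin_dependent_pair :: "real^3 \<Rightarrow> real^3 \<Rightarrow> bool" where
  "lin_dependent_pair l y \<longleftrightarrow> (\<exists>a b :: real. (a, b) \<noteq> (0, 0) \<and> a *\<^sub>R l + b *\<^sub>R y = 0)"

lemma dependent_pair_orthogonal_imp_det_zero:
  fixes e w :: "real^3"
  assumes "e \<bullet> e = 1" "e \<bullet> w = 0" "w \<noteq> 0"
    and dep: "lin_dependent_pair (A *\<^sub>R e + t *\<^sub>R w) (Y *\<^sub>R e + W *\<^sub>R w)"
  shows "A * W - t * Y = 0"
proof -
  obtain a b where ab: "(a, b) \<noteq> (0::real, 0::real)"
    and eq: "a *\<^sub>R (A *\<^sub>R e + t *\<^sub>R w) + b *\<^sub>R (Y *\<^sub>R e + W *\<^sub>R w) = 0"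
    using dep by (auto simp: lin_dependent_pair_def)
  have "e \<bullet> (a *\<^sub>R (A *\<^sub>R e + t *\<^sub>R w) + b *\<^sub>R (Y *\<^sub>R e + W *\<^sub>R w)) = a * A + b * Y"
    using assms(1,2) by (simp add: inner_add_right)
  then have 1: "a * A + b * Y = 0" by (simp add: eq)
  have "w \<bullet> (a *\<^sub>R (A *\<^sub>R e + t *\<^sub>R w) + b *\<^sub>R (Y *\<^sub>R e + W *\<^sub>R w)) = (a * t + b * W) * (w \<bullet> w)"
    using assms(2) by (simp add: inner_add_right inner_commute[of w e] algebra_simps)
  then have 2: "a * t + b * W = 0" using assms(3) by (simp add: eq)
  have "a * (A * W - t * Y) = W * (a * A + b * Y) - Y * (a * t + b * W)"
    "b * (A * W - t * Y) = A * (a * t + b * W) - t * (a * A + b * Y)"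
    by (simp_all add: algebra_simps)
  then have "a * (A * W - t * Y) = 0" "b * (A * W - t * Y) = 0" by (simp_all add: 1 2)
  with ab show ?thesis by auto
qed

text \<open>
  If the circular part is present and \<open>w \<noteq> 0\<close>, the determinant of \<open>\<ell>\<close> and \<open>y\<close> is positive for every
  \<open>t > 0\<close>, which excludes dependence at \<open>t0\<close>. In the remaining cases dependence is permanent: for
  \<open>\<mu> = 0\<close> or without circular part the path is a ray from the origin, along which \<open>y = 0\<close>, and
  without drift both \<open>\<ell>\<close> and \<open>y\<close> are multiples of \<open>e\<close>.
\<close>

lemma rot_ode_dichotomy:
  assumes ode: "rot_ode \<mu> c 0 T p" and p0: "p 0 = 0"
    and y: "\<And>t. t \<in> {0..T} \<Longrightarrow>
      ((\<lambda>\<tau>. (1/2) *\<^sub>R area_form (p \<tau>) (c + rot \<mu> (p \<tau>))) has_integral y t) {0..t}"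
    and t0: "0 < t0" "t0 \<le> T" and dep: "lin_dependent_pair (snd (p t0)) (y t0)"
    and t: "t \<in> {0..T}"
  shows "lin_dependent_pair (snd (p t)) (y t)"
proof -
  have y0: ?thesis if "y t = 0"
    unfolding lin_dependent_pair_def using that by (intro exI[of _ 0] exI[of _ 1]) simp
  show ?thesis
  proof (cases "\<mu> = 0")
    case True
    have "rot_ode \<mu> c 0 T (\<lambda>t. t *\<^sub>R c)"
      unfolding rot_ode_def True by (auto intro!: derivative_eq_intros simp: rot_def simp flip: zero_prod_def)
    then have p: "p \<tau> = \<tau> *\<^sub>R c" if "\<tau> \<in> {0..T}" for \<tau>
      using rot_ode_unique[OF ode _ _ _ that, of _ 0] p0 t0 by simp
    have "((\<lambda>\<tau>. 0) has_integral y t) {0..t}"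
    proof (rule has_integral_eq[OF _ y[OF t]])
      show "(1/2) *\<^sub>R area_form (p \<tau>) (c + rot \<mu> (p \<tau>)) = 0" if "\<tau> \<in> {0..t}" for \<tau>
        using that t p[of \<tau>] by (simp add: True rot_def area_form_def)
    qed
    then have "y t = 0" using has_integral_unique has_integral_0 by blast
    then show ?thesis by (rule y0)
  next
    case False
    define \<theta> where "\<theta> = norm \<mu>"
    define e where "e = (1 / \<theta>) *\<^sub>R \<mu>"
    define r where "r = fst c"
    define \<alpha> where "\<alpha> = e \<bullet> snd c"
    define w where "w = snd c - \<alpha> *\<^sub>R e"
    have \<theta>: "\<theta> > 0" using False by (simp add: \<theta>_def)
    have \<mu>: "\<mu> = \<theta> *\<^sub>R e" using \<theta> by (simp add: e_def)
    have ee: "e \<bullet> e = 1"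
      using \<theta> by (simp add: e_def \<theta>_def power2_norm_eq_inner[symmetric] power2_eq_square)
    have ew: "e \<bullet> w = 0" by (simp add: w_def inner_diff_right ee \<alpha>_def)
    have c: "c = (r, \<alpha> *\<^sub>R e + w)" by (simp add: r_def w_def)
    let ?x = "helix_x \<theta> r \<alpha>" and ?a = "helix_axial \<theta> r \<alpha>"
    let ?Y = "area_axial \<theta> r \<alpha>" and ?W = "area_drift \<theta> r \<alpha>"
    define q where "q t = (?x t, ?a t *\<^sub>R e + t *\<^sub>R w)" for t
    define y' where "y' t = ?Y t *\<^sub>R e + ?W t *\<^sub>R w" for t
    note hd = helix_derivatives[OF \<theta>[THEN less_imp_neq, symmetric], unfolded has_real_derivative_iff_has_vector_derivative]
    have vel: "c + rot \<mu> (q \<tau>) = (r + \<theta> * ?a \<tau>, (\<alpha> - \<theta> * ?x \<tau>) *\<^sub>R e + w)" for \<tau>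
      by (simp add: c q_def rot_def \<mu> inner_add_right ee ew algebra_simps)
    have "rot_ode \<mu> c 0 T q"
      unfolding rot_ode_def vel unfolding q_def[abs_def]
    proof
      fix \<tau>
      show "((\<lambda>t. (?x t, ?a t *\<^sub>R e + t *\<^sub>R w)) has_vector_derivative (r + \<theta> * ?a \<tau>, (\<alpha> - \<theta> * ?x \<tau>) *\<^sub>R e + w)) (at \<tau> within {0..T})"
        using has_vector_derivative_Pair[OF hd(1) has_vector_derivative_add[OF
              bounded_linear.has_vector_derivative[OF bounded_linear_scaleR_left hd(2)]
              bounded_linear.has_vector_derivative[OF bounded_linear_scaleR_left has_vector_derivative_id]]]
        by simp
    qed
    moreover have "q 0 = 0" by (simp add: q_def helix_x_def helix_axial_def zero_prod_def)
    ultimately have p: "p \<tau> = q \<tau>" if "\<tau> \<in> {0..T}" for \<tau>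
      using rot_ode_unique[OF ode _ _ _ that, of _ 0] p0 t0 by simp
    have yy: "y \<tau> = y' \<tau>" if \<tau>: "\<tau> \<in> {0..T}" for \<tau>
    proof -
      have "((\<lambda>t. ((?x t * (\<alpha> - \<theta> * ?x t) - (r + \<theta> * ?a t) * ?a t) / 2) *\<^sub>R e + ((?x t - (r + \<theta> * ?a t) * t) / 2) *\<^sub>R w)
          has_integral y' \<tau> - y' 0) {0..\<tau>}"
        unfolding y'_def using \<tau>
        by (intro fundamental_theorem_of_calculus has_vector_derivative_add
            bounded_linear.has_vector_derivative[OF bounded_linear_scaleR_left] hd) simp
      moreover have "y' 0 = 0" by (simp add: y'_def area_axial_def area_drift_def)
      ultimately have "((\<lambda>t. ((?x t * (\<alpha> - \<theta> * ?x t) - (r + \<theta> * ?a t) * ?a t) / 2) *\<^sub>R e + ((?x t - (r + \<theta> * ?a t) * t) / 2) *\<^sub>R w)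
          has_integral y' \<tau>) {0..\<tau>}" by simp
      moreover have "((\<lambda>t. ((?x t * (\<alpha> - \<theta> * ?x t) - (r + \<theta> * ?a t) * ?a t) / 2) *\<^sub>R e + ((?x t - (r + \<theta> * ?a t) * t) / 2) *\<^sub>R w)
          has_integral y \<tau>) {0..\<tau>}"
      proof (rule has_integral_eq[OF _ y[OF \<tau>]])
        fix t assume "t \<in> {0..\<tau>}"
        then have "p t = q t" using p \<tau> by simp
        then show "(1/2) *\<^sub>R area_form (p t) (c + rot \<mu> (p t)) =
            ((?x t * (\<alpha> - \<theta> * ?x t) - (r + \<theta> * ?a t) * ?a t) / 2) *\<^sub>R e + ((?x t - (r + \<theta> * ?a t) * t) / 2) *\<^sub>R w"
          unfolding \<open>p t = q t\<close> vel unfolding q_def area_form_def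
          by (simp add: vec_eq_iff field_simps)
      qed
      ultimately show ?thesis using has_integral_unique by blast
    qed
    have pos: "(0 < ?a t0 * ?W t0 - t0 * ?Y t0)" if "(r, \<alpha>) \<noteq> (0, 0)"
      by (rule helix_determinant_pos[OF \<theta> t0(1) that])
    have "w = 0 \<or> (r, \<alpha>) = (0, 0)"
    proof (rule ccontr)
      assume H: "\<not> ?thesis"
      have "lin_dependent_pair (?a t0 *\<^sub>R e + t0 *\<^sub>R w) (?Y t0 *\<^sub>R e + ?W t0 *\<^sub>R w)"
        using dep t0 p[of t0] yy[of t0] by (simp add: q_def y'_def)
      from dependent_pair_orthogonal_imp_det_zero[OF ee ew _ this] pos H show False by auto
    qed
    then show ?thesis
    proof
      assume "(r, \<alpha>) = (0, 0)"
      then have "y t = 0"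
        using yy[OF t] by (simp add: y'_def area_axial_def area_drift_def helix_x_def)
      then show ?thesis by (rule y0)
    next
      assume w: "w = 0"
      have yt: "snd (p t) = ?a t *\<^sub>R e" "y t = ?Y t *\<^sub>R e"
        using yy[OF t] p[OF t] by (simp_all add: y'_def q_def w)
      show ?thesis
      proof (cases "?a t = 0")
        case True
        then show ?thesis unfolding lin_dependent_pair_def yt by (intro exI[of _ 1] exI[of _ 0]) simp
      next
        case False
        then show ?thesis unfolding lin_dependent_pair_def yt
          by (intro exI[of _ "?Y t"] exI[of _ "- ?a t"]) simp
      qed
    qed
  qed
qed

section \<open>From geodesics to extremals\<close>

lemma AE_lebesgue_obtain_negligible:
  assumes "AE t in lebesgue. P t"
  obtains N where "negligible N" "\<And>t. t \<notin> N \<Longrightarrow> P t"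
proof -
  obtain N where "N \<in> null_sets lebesgue" "{t \<in> space lebesgue. \<not> P t} \<subseteq> N"
    using assms unfolding eventually_ae_filter by blast
  then show thesis
    by (intro that[of N]) (auto simp: negligible_iff_null_sets)
qed

lemma geodesic_velocity:
  assumes geo: "sr_geodesic_on {0..} \<gamma>" and ab: "0 \<le> a" "a < b"
  obtains N u s where "negligible N"
    "\<And>t. t \<in> {a..b} - N \<Longrightarrow> (\<gamma> has_vector_derivative frame_comb (\<gamma> t) (u t)) (at t within {a..b})"
    "\<And>t. t \<in> {a..b} - N \<Longrightarrow> norm (u t) = s"
proof -
  from geo obtain s where s: "AE t in lebesgue. t \<in> {0..} \<longrightarrow>
      sr_norm (\<gamma> t) (vector_derivative \<gamma> (at t within {0..})) = s"
    unfolding sr_geodesic_on_def by blast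
  obtain N1 where N1: "negligible N1" "\<And>t. t \<notin> N1 \<Longrightarrow> t \<in> {0..} \<longrightarrow>
      sr_norm (\<gamma> t) (vector_derivative \<gamma> (at t within {0..})) = s"
    using AE_lebesgue_obtain_negligible[OF s] by blast
  have "{a..b} \<subseteq> {0..}" "a \<le> b" using ab by auto
  with geo have "admissible_on {a..b} \<gamma>"
    unfolding sr_geodesic_on_def by blast
  then have "AE t in lebesgue. t \<in> {a..b} \<longrightarrow>
      (\<exists>v \<in> distribution (\<gamma> t). (\<gamma> has_vector_derivative v) (at t within {a..b}))"
    unfolding admissible_on_def by blast
  then obtain N2 where N2: "negligible N2" "\<And>t. t \<notin> N2 \<Longrightarrow> t \<in> {a..b} \<longrightarrow>
      (\<exists>v \<in> distribution (\<gamma> t). (\<gamma> has_vector_derivative v) (at t within {a..b}))"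
    using AE_lebesgue_obtain_negligible by blast
  define u where "u t = frame_coords (\<gamma> t) (vector_derivative \<gamma> (at t within {a..b}))" for t
  define N where "N = N1 \<union> N2 \<union> {a, b}"
  have d: "(\<gamma> has_vector_derivative frame_comb (\<gamma> t) (u t)) (at t within {a..b}) \<and> norm (u t) = s"
    if t: "t \<in> {a..b} - N" for t
  proof -
    obtain v where v: "(\<gamma> has_vector_derivative frame_comb (\<gamma> t) v) (at t within {a..b})"
      using N2(2)[of t] t by (auto simp: N_def distribution_eq_range)
    moreover have "vector_derivative \<gamma> (at t within {a..b}) = frame_comb (\<gamma> t) v"
      using v ab t by (intro vector_derivative_within_closed_interval) auto
    ultimately have u: "u t = v" by (simp add: u_def)
    have "a < t" "t < b" using t by (auto simp: N_def)
    then have "at t within {a..b} = at t within {0..}"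
      using ab by (intro at_within_nhd[of t "{a<..<b}"]) auto
    then have "sr_norm (\<gamma> t) (vector_derivative \<gamma> (at t within {a..b})) = s"
      using N1(2)[of t] t ab by (auto simp: N_def)
    moreover have "sr_norm (\<gamma> t) (vector_derivative \<gamma> (at t within {a..b})) = norm v"
      using ab t by (intro sr_speed[OF v]) auto
    ultimately show ?thesis using u v by simp
  qed
  have "negligible N"
    unfolding N_def using N1 N2 by (intro negligible_Un) auto
  then show thesis by (rule that[OF _ conjunct1[OF d] conjunct2[OF d]])
qed

text \<open>
  If the speed is positive, the first variation applies; otherwise the planar path is constant and
  solves the equation with zero data.
\<close>

lemma minimizer_imp_rot_ode:
  assumes "a < b" and min: "length_minimizer \<gamma> a b" and N: "negligible N"
    and vel: "\<And>t. t \<in> {a..b} - N \<Longrightarrow>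
      (\<gamma> has_vector_derivative frame_comb (\<gamma> t) (u t)) (at t within {a..b})"
    and speed: "\<And>t. t \<in> {a..b} - N \<Longrightarrow> norm (u t) = s"
  shows "\<exists>\<mu> c. rot_ode \<mu> c a b (\<lambda>t. planar (\<gamma> t))"
proof -
  obtain L where L: "L-lipschitz_on {a..b} \<gamma>"
    using min by (auto simp: length_minimizer_def admissible_on_def)
  obtain K where K: "K-lipschitz_on {a..b} (\<lambda>t. planar (\<gamma> t))"
    using bounded_linear.lipschitz_on_image[OF bounded_linear_planar L] by blast
  show ?thesis
  proof (cases "s > 0")
    case True
    have "area_constrained_minimal a b (\<lambda>t. planar (\<gamma> t))"
      unfolding area_constrained_minimal_def
    proof (intro allI impI, elim conjE)
      fix \<phi> \<psi> \<psi>' :: "real \<Rightarrow> real \<times> (real^3)"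
      assume "\<forall>t\<in>{a..b}. (\<phi> has_vector_derivative \<psi> t) (at t within {a..b})" "\<phi> a = 0" "\<phi> b = 0"
        and \<psi>: "test_function a b \<psi> \<psi>'"
        and "integral {a..b} (\<lambda>t. area_form (planar (\<gamma> t) + (1/2) *\<^sub>R \<phi> t) (\<psi> t)) = 0"
      then show "0 \<le> 2 * weak_pairing a b (\<lambda>t. planar (\<gamma> t)) \<psi> \<psi>' + integral {a..b} (\<lambda>t. \<psi> t \<bullet> \<psi> t)"
        using test_functionD[OF \<psi>]
        by (intro minimizer_first_variation[OF \<open>a < b\<close> min True N vel speed]) auto
    qed
    from minimal_imp_ode[OF \<open>a < b\<close> lipschitz_on_continuous_on[OF K] this]
    show ?thesis by (simp add: rot_ode_def)
  next
    case False
    have d0: "((\<lambda>t. planar (\<gamma> t)) has_vector_derivative 0) (at t within {a..b})" if "t \<in> {a..b} - N" for t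
    proof -
      have "u t = 0" using speed[OF that] False by (metis norm_ge_zero norm_le_zero_iff not_less)
      then show ?thesis
        using bounded_linear.has_vector_derivative[OF bounded_linear_planar vel[OF that]]
        by (simp add: planar_frame_comb)
    qed
    have const: "planar (\<gamma> t) = planar (\<gamma> a)" if t: "t \<in> {a..b}" for t
    proof -
      have "((\<lambda>_. 0) has_integral planar (\<gamma> t) - planar (\<gamma> a)) {a..t}"
      proof (rule lipschitz_fundamental_theorem[OF lipschitz_on_subset[OF K] _ N])
        fix \<tau> assume "\<tau> \<in> {a..t} - N"
        then show "((\<lambda>t. planar (\<gamma> t)) has_vector_derivative 0) (at \<tau> within {a..t})"
          using t by (intro has_vector_derivative_within_subset[OF d0]) auto
      qed (use t in auto)
      then show ?thesis using has_integral_unique has_integral_0 by (metis eq_iff_diff_eq_0)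
    qed
    have "rot_ode 0 0 a b (\<lambda>t. planar (\<gamma> t))"
      unfolding rot_ode_def
    proof
      fix t assume t: "t \<in> {a..b}"
      have "((\<lambda>t. planar (\<gamma> t)) has_vector_derivative 0) (at t within {a..b})"
        using has_vector_derivative_transform[OF t const, of "\<lambda>t. t"] by simp
      then show "((\<lambda>t. planar (\<gamma> t)) has_vector_derivative 0 + rot 0 (planar (\<gamma> t))) (at t within {a..b})"
        by (simp add: rot_def flip: zero_prod_def)
    qed
    then show ?thesis by blast
  qed
qed

text \<open>
  Minimality is only local, so a priori the multiplier depends on the arc. Bisection of \<open>[0, T]\<close>
  joins finitely many arcs. Gluing needs arcs that overlap in an interval, whereas bisection
  produces adjacent ones; the predicate \<open>P a b\<close> therefore asks for the equation on a slightly
  larger interval than \<open>[a, b]\<close>, cut off at 0 where the geodesic starts.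
\<close>

lemma geodesic_rot_ode:
  assumes geo: "sr_geodesic_on {0..} \<gamma>" and "0 < T"
  shows "\<exists>\<mu> c. rot_ode \<mu> c 0 T (\<lambda>t. planar (\<gamma> t))"
proof -
  let ?p = "\<lambda>t. planar (\<gamma> t)"
  define P where "P a b \<longleftrightarrow> 0 \<le> b \<and> (\<exists>\<epsilon>>0. \<exists>\<mu> c. rot_ode \<mu> c (max 0 (a - \<epsilon>)) (b + \<epsilon>) ?p)" for a b
  have "P 0 T"
  proof (rule Bolzano)
    show "0 \<le> T" using \<open>0 < T\<close> by simp
  next
    fix a b c assume "P a b" "P b c" and le: "a \<le> b" "b \<le> c"
    then obtain \<epsilon>1 \<mu>1 c1 \<epsilon>2 \<mu>2 c2 where b0: "0 \<le> b" and c0: "0 \<le> c" and eps: "\<epsilon>1 > 0" "\<epsilon>2 > 0"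
      and o1: "rot_ode \<mu>1 c1 (max 0 (a - \<epsilon>1)) (b + \<epsilon>1) ?p"
      and o2: "rot_ode \<mu>2 c2 (max 0 (b - \<epsilon>2)) (c + \<epsilon>2) ?p"
      unfolding P_def by blast
    define \<epsilon> where "\<epsilon> = min \<epsilon>1 \<epsilon>2"
    have \<epsilon>: "\<epsilon> > 0" "\<epsilon> \<le> \<epsilon>1" "\<epsilon> \<le> \<epsilon>2" using eps by (auto simp: \<epsilon>_def)
    have "rot_ode \<mu>1 c1 (max 0 (a - \<epsilon>)) (b + \<epsilon>) ?p"
      using \<epsilon> by (intro rot_ode_subinterval[OF o1]) auto
    moreover have "rot_ode \<mu>2 c2 (max 0 (b - \<epsilon>)) (c + \<epsilon>) ?p"
      using \<epsilon> by (intro rot_ode_subinterval[OF o2]) auto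
    ultimately have "\<exists>\<mu> k. rot_ode \<mu> k (max 0 (a - \<epsilon>)) (c + \<epsilon>) ?p"
      by (rule rot_ode_glue) (use le \<epsilon> b0 in auto)
    then show "P a c" unfolding P_def using c0 \<epsilon>(1) by blast
  next
    fix x assume x: "0 \<le> x" "x \<le> T"
    then have "x \<in> {0..}" by simp
    with geo obtain \<delta> where \<delta>: "\<delta> > 0"
      "\<And>a b. a \<le> b \<and> {a..b} \<subseteq> {0..} \<inter> ball x \<delta> \<Longrightarrow> length_minimizer \<gamma> a b"
      unfolding sr_geodesic_on_def by meson
    show "\<exists>d>0. \<forall>a b. a \<le> x \<and> x \<le> b \<and> b - a < d \<longrightarrow> P a b"
    proof (intro exI conjI allI impI)
      show "\<delta> / 4 > 0" using \<delta> by simp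
      fix a b assume ab: "a \<le> x \<and> x \<le> b \<and> b - a < \<delta> / 4"
      let ?a = "max 0 (a - \<delta> / 4)" and ?b = "b + \<delta> / 4"
      have lt: "?a < ?b" "0 \<le> ?a" using ab x \<delta>(1) by auto
      obtain N u s where v: "negligible N"
        "\<And>t. t \<in> {?a..?b} - N \<Longrightarrow> (\<gamma> has_vector_derivative frame_comb (\<gamma> t) (u t)) (at t within {?a..?b})"
        "\<And>t. t \<in> {?a..?b} - N \<Longrightarrow> norm (u t) = s"
        using geodesic_velocity[OF geo lt(2,1)] by metis
      have "{?a..?b} \<subseteq> {0..} \<inter> ball x \<delta>"
        using ab x \<delta>(1) by (auto simp: dist_real_def)
      then have "length_minimizer \<gamma> ?a ?b"
        using lt by (intro \<delta>(2)) auto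
      from minimizer_imp_rot_ode[OF lt(1) this v]
      show "P a b" unfolding P_def using \<delta>(1) ab x
        by (intro conjI exI[of _ "\<delta> / 4"]) auto
    qed
  qed
  then obtain \<epsilon> \<mu> c where "\<epsilon> > 0" and o: "rot_ode \<mu> c (max 0 (0 - \<epsilon>)) (T + \<epsilon>) ?p"
    unfolding P_def by blast
  then have "rot_ode \<mu> c 0 T ?p" by (intro rot_ode_subinterval[OF o]) auto
  then show ?thesis by blast
qed

text \<open>
  Once \<open>p\<close> is known to be continuously differentiable, its derivative agrees almost everywhere
  with the velocity of the geodesic, so \<open>y\<close> is recovered from \<open>p\<close> by the area formula.
\<close>

lemma geodesic_vertical_integral:
  assumes geo: "sr_geodesic_on {0..} \<gamma>" and ode: "rot_ode \<mu> c 0 T (\<lambda>t. planar (\<gamma> t))"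
    and t: "0 \<le> t" "t \<le> T"
  shows "((\<lambda>\<tau>. (1/2) *\<^sub>R area_form (planar (\<gamma> \<tau>)) (c + rot \<mu> (planar (\<gamma> \<tau>)))) has_integral
    snd (snd (\<gamma> t)) - snd (snd (\<gamma> 0))) {0..t}"
proof (cases "t = 0")
  case True
  show ?thesis
    unfolding True atLeastAtMost_singleton diff_self by (rule has_integral_refl(2))
next
  case False
  then have "0 < t" using t by simp
  obtain N u s where N: "negligible N" and vel:
    "\<And>\<tau>. \<tau> \<in> {0..t} - N \<Longrightarrow> (\<gamma> has_vector_derivative frame_comb (\<gamma> \<tau>) (u \<tau>)) (at \<tau> within {0..t})"
    using geodesic_velocity[OF geo order_refl \<open>0 < t\<close>] by metis
  have "{0..t} \<subseteq> {0..}" by auto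
  with geo \<open>0 \<le> t\<close> have "admissible_on {0..t} \<gamma>" unfolding sr_geodesic_on_def by blast
  then obtain L where L: "L-lipschitz_on {0..t} \<gamma>" by (auto simp: admissible_on_def)
  have bl: "bounded_linear (\<lambda>v::carnot. snd (snd v))"
    by (intro bounded_linear_snd_comp bounded_linear_snd)
  obtain K where K: "K-lipschitz_on {0..t} (\<lambda>t. snd (snd (\<gamma> t)))"
    using bounded_linear.lipschitz_on_image[OF bl L] by blast
  show ?thesis
  proof (rule lipschitz_fundamental_theorem[OF K \<open>0 \<le> t\<close> N])
    fix \<tau> assume \<tau>: "\<tau> \<in> {0..t} - N"
    have "((\<lambda>t. planar (\<gamma> t)) has_vector_derivative u \<tau>) (at \<tau> within {0..t})"
      using bounded_linear.has_vector_derivative[OF bounded_linear_planar vel[OF \<tau>]]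
      by (simp add: planar_frame_comb)
    moreover have "((\<lambda>t. planar (\<gamma> t)) has_vector_derivative c + rot \<mu> (planar (\<gamma> \<tau>))) (at \<tau> within {0..t})"
      using \<tau> t by (intro rot_odeD[OF rot_ode_subinterval[OF ode]]) auto
    ultimately have "u \<tau> = c + rot \<mu> (planar (\<gamma> \<tau>))"
      using vector_derivative_within_closed_interval[OF \<open>0 < t\<close>, of \<tau>] \<tau> by (metis DiffD1)
    then show "((\<lambda>t. snd (snd (\<gamma> t))) has_vector_derivative
        (1/2) *\<^sub>R area_form (planar (\<gamma> \<tau>)) (c + rot \<mu> (planar (\<gamma> \<tau>)))) (at \<tau> within {0..t})"
      using bounded_linear.has_vector_derivative[OF bl vel[OF \<tau>]]
      by (simp add: frame_comb_area_form)
  qed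
qed

lemma Cn_iff: "v \<in> Cn \<longleftrightarrow> lin_dependent_pair (snd (planar v)) (snd (snd v))"
  by (cases v) (simp add: Cn_def planar_def lin_dependent_pair_def)

theorem theorem1:
  fixes \<gamma> :: "real \<Rightarrow> carnot"
  assumes "sr_geodesic_on {0..} \<gamma>"
    and "\<gamma> 0 = origin"
  shows "(\<forall>t>0. \<gamma> t \<notin> Cn) \<or> (\<forall>t\<ge>0. \<gamma> t \<in> Cn)"
proof (rule disjCI)
  assume "\<not> (\<forall>t\<ge>0. \<gamma> t \<in> Cn)"
  then obtain t1 where t1: "t1 \<ge> 0" "\<gamma> t1 \<notin> Cn" by blast
  show "\<forall>t>0. \<gamma> t \<notin> Cn"
  proof (intro allI impI notI)
    fix t0 :: real assume t0: "0 < t0" "\<gamma> t0 \<in> Cn"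
    \<comment> \<open>The time of contact \<open>t0\<close> and the time \<open>t1\<close> outside lie on one arc with a single multiplier.\<close>
    define T where "T = max t0 t1"
    have "0 < T" using t0 by (simp add: T_def)
    then obtain \<mu> c where ode: "rot_ode \<mu> c 0 T (\<lambda>t. planar (\<gamma> t))"
      using geodesic_rot_ode[OF assms(1)] by blast
    have p0: "planar (\<gamma> 0) = 0" and y0: "snd (snd (\<gamma> 0)) = 0"
      by (simp_all add: assms(2) origin_def planar_def zero_prod_def)
    have "lin_dependent_pair (snd (planar (\<gamma> t1))) (snd (snd (\<gamma> t1)))"
    proof (rule rot_ode_dichotomy[OF ode p0 _ t0(1)])
      show "((\<lambda>\<tau>. (1/2) *\<^sub>R area_form (planar (\<gamma> \<tau>)) (c + rot \<mu> (planar (\<gamma> \<tau>)))) has_integral snd (snd (\<gamma> t))) {0..t}"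
        if "t \<in> {0..T}" for t
        using geodesic_vertical_integral[OF assms(1) ode, of t] that y0 by simp
      show "lin_dependent_pair (snd (planar (\<gamma> t0))) (snd (snd (\<gamma> t0)))"
        using t0(2) by (simp add: Cn_iff)
    qed (use t1 T_def in auto)
    then show False using t1(2) by (simp add: Cn_iff)
  qed
qed

end
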